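(* Let $n,m\ge1$, let $\mathbb{S}_n=\{x\in\mathbb{R}^n:\sum_i x_i=1,\ x_i\ge 0\}$, and let $\{f_j\}_{j\in[m]}$ be differentiable convex functions defining the feasibility program $$f_j(x)\le 0\quad \forall j\in[m],\qquad x\in\mathbb{S}_n ,$$ with $\|\nabla f_j(x)\|_2\le G$ for all $j\in[m]$ and $x\in\mathbb{S}_n$. There exists an algorithm that for any $\varepsilon>0$ returns an $\varepsilon$-approximate solution to this program. The algorithm makes at most $\tilde{O}\!\left(\frac{nG}{\varepsilon}\right)$ calls to the Separation Oracle and requires computation of a generalized projection onto $\mathbb{S}_n$, a single gradient computation and additional $\tilde{O}(n^2)$ time between successive oracle calls.
   Context: An $\varepsilon$-approximate solution (additive notion) is either a point $x\in\mathbb{S}_n$ with $f_j(x)\le\varepsilon$ for all $j\in[m]$, or a proof that the program is infeasible. The Separation Oracle, on input $x\in\mathbb{S}_n$, returns an index $j\in[m]$ with $f_j(x)>\varepsilon$ if such an index exists, and returns FAIL otherwise. The generalized projection of $y\in\mathbb{R}^n$ onto a convex set $\mathcal{P}$ with respect to a positive semidefinite matrix $A$ is $\arg\min_{x\in\mathcal{P}}(x-y)^\top A(x-y)$. $\tilde{O}(\cdot)$ hides polylogarithmic factors. *)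

theory Defs
  imports Complex_Main "Jordan_Normal_Form.Matrix"
begin

section \<open>The feasibility program\<close>

text \<open>
  The dimension \<open>n\<close> is quantified inside the claim (the constants hidden by the soft-O notation
  must not depend on it), so \<open>\<real>\<^sup>n\<close> is \<^term>\<open>carrier_vec n :: real vec set\<close>. Indices in \<open>[n]\<close> and
  \<open>[m]\<close> are counted from 0.
\<close>

definition simplex :: "nat \<Rightarrow> real vec set" where
  "simplex n = {x \<in> carrier_vec n. (\<forall>i<n. 0 \<le> x $ i) \<and> (\<Sum>i<n. x $ i) = 1}"

definition l2norm :: "real vec \<Rightarrow> real" where
  "l2norm x = sqrt (x \<bullet> x)"

text \<open>Frechet differentiability on \<open>\<real>\<^sup>n\<close>; the type \<^typ>\<open>real vec\<close> carries no topology.\<close>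

definition has_gradient :: "nat \<Rightarrow> (real vec \<Rightarrow> real) \<Rightarrow> real vec \<Rightarrow> real vec \<Rightarrow> bool" where
  "has_gradient n h x g \<longleftrightarrow> g \<in> carrier_vec n \<and>
     (\<forall>e>0. \<exists>d>0. \<forall>y\<in>carrier_vec n. l2norm (y - x) < d \<longrightarrow>
        \<bar>h y - h x - g \<bullet> (y - x)\<bar> \<le> e * l2norm (y - x))"

definition convex_fun_on :: "real vec set \<Rightarrow> (real vec \<Rightarrow> real) \<Rightarrow> bool" where
  "convex_fun_on S h \<longleftrightarrow> (\<forall>x\<in>S. \<forall>y\<in>S. \<forall>t. 0 \<le> t \<longrightarrow> t \<le> 1 \<longrightarrow>
     h ((1 - t) \<cdot>\<^sub>v x + t \<cdot>\<^sub>v y) \<le> (1 - t) * h x + t * h y)"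

text \<open>
  Convexity and differentiability are only required at the points of the simplex, so functions
  that are convex and differentiable on all of \<open>\<real>\<^sup>n\<close>, or just on a neighbourhood of the simplex,
  are all covered. \<open>df j x\<close> is the gradient of \<open>f j\<close> at \<open>x\<close>.
\<close>

definition convex_program ::
  "nat \<Rightarrow> nat \<Rightarrow> (nat \<Rightarrow> real vec \<Rightarrow> real) \<Rightarrow> (nat \<Rightarrow> real vec \<Rightarrow> real vec) \<Rightarrow> bool" where
  "convex_program n m f df \<longleftrightarrow>
     (\<forall>j<m. convex_fun_on (simplex n) (f j) \<and> (\<forall>x\<in>simplex n. has_gradient n (f j) x (df j x)))"

definition feasible :: "nat \<Rightarrow> nat \<Rightarrow> (nat \<Rightarrow> real vec \<Rightarrow> real) \<Rightarrow> real vec \<Rightarrow> bool" where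
  "feasible n m f x \<longleftrightarrow> x \<in> simplex n \<and> (\<forall>j<m. f j x \<le> 0)"

text \<open>
  A proof of infeasibility is an explicit certificate: a list of pairs \<open>(j, x)\<close> whose
  linearised constraints \<open>f\<^sub>j(x) + \<nabla>f\<^sub>j(x) \<bullet> (u - x) \<le> 0\<close>, each of which is implied by
  \<open>f\<^sub>j(u) \<le> 0\<close>, form a system of linear inequalities without solution in the simplex.
\<close>

definition infeasibility_proof ::
  "nat \<Rightarrow> nat \<Rightarrow> (nat \<Rightarrow> real vec \<Rightarrow> real) \<Rightarrow> (nat \<Rightarrow> real vec \<Rightarrow> real vec) \<Rightarrow> (nat \<times> real vec) list \<Rightarrow> bool"
  where
  "infeasibility_proof n m f df c \<longleftrightarrow>
     (\<forall>(j, x)\<in>set c. j < m \<and> x \<in> simplex n) \<and>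
     (\<forall>u\<in>simplex n. \<exists>(j, x)\<in>set c. f j x + df j x \<bullet> (u - x) > 0)"

lemma l2norm_smult: "l2norm (t \<cdot>\<^sub>v v) = \<bar>t\<bar> * l2norm v"
proof -
  have "(t \<cdot>\<^sub>v v) \<bullet> (t \<cdot>\<^sub>v v) = t\<^sup>2 * (v \<bullet> v)"
    by (simp add: scalar_prod_def sum_distrib_left power2_eq_square algebra_simps)
  then show ?thesis by (simp add: l2norm_def real_sqrt_mult)
qed

lemma l2norm_nonneg: "0 \<le> l2norm v"
  by (simp add: l2norm_def scalar_prod_def sum_nonneg)

lemma gradient_inequality:
  assumes cv: "convex_fun_on S h" and S: "S \<subseteq> carrier_vec n" and x: "x \<in> S" and u: "u \<in> S"
    and g: "has_gradient n h x g"
  shows "h x + g \<bullet> (u - x) \<le> h u"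
proof (rule field_le_epsilon)
  fix e' :: real assume e': "0 < e'"
  have cx: "x \<in> carrier_vec n" and cu: "u \<in> carrier_vec n" using S x u by auto
  define L where "L = l2norm (u - x)"
  have L: "0 \<le> L" unfolding L_def by (rule l2norm_nonneg)
  define e where "e = e' / (L + 1)"
  have e: "0 < e" using e' L by (simp add: e_def)
  obtain d where d: "d > 0" and D: "\<And>y. y \<in> carrier_vec n \<Longrightarrow> l2norm (y - x) < d \<Longrightarrow>
      \<bar>h y - h x - g \<bullet> (y - x)\<bar> \<le> e * l2norm (y - x)"
    using g e unfolding has_gradient_def by blast
  define t where "t = min 1 (d / (2 * (L + 1)))"
  have t: "0 < t" "t \<le> 1" using d L by (auto simp: t_def)
  have "t * L \<le> d / (2 * (L + 1)) * L" unfolding t_def by (rule mult_right_mono) (use L in auto)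
  also have "\<dots> = d * (L / (2 * (L + 1)))" by simp
  also have "\<dots> < d * 1" using d L by (intro mult_strict_left_mono) (simp_all add: divide_simps)
  also have "\<dots> = d" by simp
  finally have tL: "t * L < d" .
  define y where "y = (1 - t) \<cdot>\<^sub>v x + t \<cdot>\<^sub>v u"
  have cy: "y \<in> carrier_vec n" using cx cu by (simp add: y_def)
  have yx: "y - x = t \<cdot>\<^sub>v (u - x)"
    using cx cu by (intro eq_vecI) (simp_all add: y_def algebra_simps)
  have ny: "l2norm (y - x) = t * L" using t by (simp add: yx l2norm_smult L_def)
  have cg: "g \<in> carrier_vec n" using g by (simp add: has_gradient_def)
  have gy: "g \<bullet> (y - x) = t * (g \<bullet> (u - x))" using cg cx cu by (simp add: yx)
  have "h y \<le> (1 - t) * h x + t * h u"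
    using cv x u t unfolding convex_fun_on_def y_def by simp
  moreover have "h y \<ge> h x + t * (g \<bullet> (u - x)) - e * (t * L)"
    using D[OF cy] tL unfolding ny gy by linarith
  ultimately have "t * (h x + g \<bullet> (u - x)) \<le> t * (h u + e * L)"
    by (simp add: algebra_simps)
  then have "h x + g \<bullet> (u - x) \<le> h u + e * L" using t by simp
  also have "e * L \<le> e'" using e' L by (simp add: e_def field_simps)
  finally show "h x + g \<bullet> (u - x) \<le> h u + e'" by simp
qed

lemma infeasibility_proof_sound:
  assumes "convex_program n m f df" and "infeasibility_proof n m f df c"
  shows "\<not> feasible n m f u"
proof
  assume u: "feasible n m f u"
  then obtain j x where jx: "(j, x) \<in> set c" and pos: "f j x + df j x \<bullet> (u - x) > 0"
    using assms(2) unfolding infeasibility_proof_def feasible_def by blast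
  have j: "j < m" and x: "x \<in> simplex n"
    using assms(2) jx unfolding infeasibility_proof_def by auto
  have "f j x + df j x \<bullet> (u - x) \<le> f j u"
    using assms(1) u j x
    by (intro gradient_inequality[where S = "simplex n" and n = n])
       (auto simp: convex_program_def feasible_def simplex_def)
  moreover have "f j u \<le> 0" using u j by (simp add: feasible_def)
  ultimately show False using pos by simp
qed

datatype answer = Solution "real vec" | Infeasible "(nat \<times> real vec) list"

fun approximate_solution ::
  "nat \<Rightarrow> nat \<Rightarrow> (nat \<Rightarrow> real vec \<Rightarrow> real) \<Rightarrow> (nat \<Rightarrow> real vec \<Rightarrow> real vec) \<Rightarrow> real \<Rightarrow> answer \<Rightarrow> bool" where
  "approximate_solution n m f df \<epsilon> (Solution x) \<longleftrightarrow> x \<in> simplex n \<and> (\<forall>j<m. f j x \<le> \<epsilon>)"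
| "approximate_solution n m f df \<epsilon> (Infeasible c) \<longleftrightarrow> infeasibility_proof n m f df c"


section \<open>Oracles\<close>

text \<open>\<^term>\<open>None\<close> is the answer FAIL.\<close>

definition separation_oracle ::
  "nat \<Rightarrow> nat \<Rightarrow> (nat \<Rightarrow> real vec \<Rightarrow> real) \<Rightarrow> real \<Rightarrow> (real vec \<Rightarrow> nat option) \<Rightarrow> bool" where
  "separation_oracle n m f \<epsilon> sep \<longleftrightarrow>
     (\<forall>x\<in>simplex n. case sep x of
        Some j \<Rightarrow> j < m \<and> f j x > \<epsilon>
      | None \<Rightarrow> \<not> (\<exists>j<m. f j x > \<epsilon>))"

definition pos_semidef :: "nat \<Rightarrow> real mat \<Rightarrow> bool" where
  "pos_semidef n A \<longleftrightarrow> A \<in> carrier_mat n n \<and> transpose_mat A = A \<and>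
     (\<forall>v\<in>carrier_vec n. 0 \<le> v \<bullet> (A *\<^sub>v v))"

definition generalized_projection ::
  "real vec set \<Rightarrow> real mat \<Rightarrow> real vec \<Rightarrow> real vec \<Rightarrow> bool" where
  "generalized_projection P A y z \<longleftrightarrow>
     is_arg_min (\<lambda>x. (x - y) \<bullet> (A *\<^sub>v (x - y))) (\<lambda>x. x \<in> P) z"

text \<open>For singular \<open>A\<close> the minimiser need not be unique; the oracle may return any of them.\<close>

definition projection_oracle :: "nat \<Rightarrow> (real mat \<Rightarrow> real vec \<Rightarrow> real vec) \<Rightarrow> bool" where
  "projection_oracle n proj \<longleftrightarrow>
     (\<forall>A y. pos_semidef n A \<longrightarrow> y \<in> carrier_vec n \<longrightarrow>
        generalized_projection (simplex n) A y (proj A y))"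


section \<open>Oracle algorithms: programs of a real RAM\<close>

text \<open>
  The machine has a memory of natural numbers (indices, addresses, counters) and a memory of
  reals, both indirectly addressable. Arithmetic on reals is exact. There is no rounding, no
  conversion of reals to naturals and no multiplication of naturals, and the only constants are
  integers. Programs are finite syntactic objects that do not depend on \<open>n\<close>, \<open>m\<close> or the instance,
  and they have access to the functions \<open>f\<^sub>j\<close> only through the three oracle instructions.
\<close>

datatype nexp = NConst nat | NLoad nexp | NAdd nexp nexp | NSub nexp nexp

datatype rexp = RConst int | RLoad nexp | ROfNat nexp
  | RAdd rexp rexp | RSub rexp rexp | RMul rexp rexp | RDiv rexp rexp

datatype bexp = NLess nexp nexp | RLess rexp rexp | BNot bexp | BAnd bexp bexp

datatype com = Skip
  | NStore nexp nexp
  | RStore nexp rexp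
  | Seq com com
  | Cond bexp com com
  | While bexp com
  | Separate nexp nexp
  | Gradient nexp nexp nexp
  | Project nexp nexp nexp

record memory =
  nmem :: "nat \<Rightarrow> nat"
  rmem :: "nat \<Rightarrow> real"

fun nval :: "nexp \<Rightarrow> memory \<Rightarrow> nat" where
  "nval (NConst k) s = k"
| "nval (NLoad a) s = nmem s (nval a s)"
| "nval (NAdd a b) s = nval a s + nval b s"
| "nval (NSub a b) s = nval a s - nval b s"

fun rval :: "rexp \<Rightarrow> memory \<Rightarrow> real" where
  "rval (RConst k) s = of_int k"
| "rval (RLoad a) s = rmem s (nval a s)"
| "rval (ROfNat a) s = of_nat (nval a s)"
| "rval (RAdd a b) s = rval a s + rval b s"
| "rval (RSub a b) s = rval a s - rval b s"
| "rval (RMul a b) s = rval a s * rval b s"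
| "rval (RDiv a b) s = rval a s / rval b s"

fun bval :: "bexp \<Rightarrow> memory \<Rightarrow> bool" where
  "bval (NLess a b) s = (nval a s < nval b s)"
| "bval (RLess a b) s = (rval a s < rval b s)"
| "bval (BNot b) s = (\<not> bval b s)"
| "bval (BAnd b c) s = (bval b s \<and> bval c s)"

definition set_nmem :: "nat \<Rightarrow> nat \<Rightarrow> memory \<Rightarrow> memory" where
  "set_nmem a k s = s\<lparr>nmem := (nmem s)(a := k)\<rparr>"

definition set_rmem :: "nat \<Rightarrow> real \<Rightarrow> memory \<Rightarrow> memory" where
  "set_rmem a r s = s\<lparr>rmem := (rmem s)(a := r)\<rparr>"

definition get_vec :: "nat \<Rightarrow> nat \<Rightarrow> memory \<Rightarrow> real vec" where
  "get_vec n a s = vec n (\<lambda>i. rmem s (a + i))"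

definition get_mat :: "nat \<Rightarrow> nat \<Rightarrow> memory \<Rightarrow> real mat" where
  "get_mat n a s = mat n n (\<lambda>(i, k). rmem s (a + i * n + k))"

definition set_vec :: "nat \<Rightarrow> nat \<Rightarrow> real vec \<Rightarrow> memory \<Rightarrow> memory" where
  "set_vec n a v s = s\<lparr>rmem := (\<lambda>i. if a \<le> i \<and> i < a + n then v $ (i - a) else rmem s i)\<rparr>"

text \<open>
  Execution produces a trace with one \<open>Tick\<close> for every assignment, skip and evaluation of a
  branching or loop condition, and one event for every oracle call. The expressions occurring in
  a program have a size fixed by the program text, so that charging a whole expression one unit
  changes running times by a constant factor only.

  The answer of the separation oracle is encoded as 0 for FAIL and \<open>j + 1\<close> for \<open>j\<close>. An oracle
  call whose argument is not admissible (a query point outside the simplex, an index that is not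
  below \<open>m\<close>, a matrix that is not positive semidefinite) has no successor state, hence a program
  making one has no run.
\<close>

datatype event = Tick | SepCall | GradCall | ProjCall

record oracles =
  dim :: nat
  num :: nat
  separate :: "real vec \<Rightarrow> nat option"
  gradient :: "nat \<Rightarrow> real vec \<Rightarrow> real vec"
  project :: "real mat \<Rightarrow> real vec \<Rightarrow> real vec"

inductive run :: "oracles \<Rightarrow> com \<Rightarrow> memory \<Rightarrow> event list \<Rightarrow> memory \<Rightarrow> bool"
  for orc :: oracles where
  run_Skip: "run orc Skip s [Tick] s"
| run_NStore: "run orc (NStore a e) s [Tick] (set_nmem (nval a s) (nval e s) s)"
| run_RStore: "run orc (RStore a e) s [Tick] (set_rmem (nval a s) (rval e s) s)"
| run_Seq: "run orc c s tr s' \<Longrightarrow> run orc d s' tr' s'' \<Longrightarrow> run orc (Seq c d) s (tr @ tr') s''"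
| run_CondTrue: "bval b s \<Longrightarrow> run orc c s tr s' \<Longrightarrow> run orc (Cond b c d) s (Tick # tr) s'"
| run_CondFalse: "\<not> bval b s \<Longrightarrow> run orc d s tr s' \<Longrightarrow> run orc (Cond b c d) s (Tick # tr) s'"
| run_WhileFalse: "\<not> bval b s \<Longrightarrow> run orc (While b c) s [Tick] s"
| run_WhileTrue: "bval b s \<Longrightarrow> run orc c s tr s' \<Longrightarrow> run orc (While b c) s' tr' s'' \<Longrightarrow>
    run orc (While b c) s (Tick # tr @ tr') s''"
| run_Separate: "x = get_vec (dim orc) (nval a s) s \<Longrightarrow> x \<in> simplex (dim orc) \<Longrightarrow>
    run orc (Separate a r) s [SepCall]
      (set_nmem (nval r s) (case separate orc x of None \<Rightarrow> 0 | Some j \<Rightarrow> j + 1) s)"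
| run_Gradient: "x = get_vec (dim orc) (nval a s) s \<Longrightarrow> x \<in> simplex (dim orc) \<Longrightarrow>
    nval j s < num orc \<Longrightarrow>
    run orc (Gradient j a r) s [GradCall] (set_vec (dim orc) (nval r s) (gradient orc (nval j s) x) s)"
| run_Project: "A = get_mat (dim orc) (nval a s) s \<Longrightarrow> pos_semidef (dim orc) A \<Longrightarrow>
    y = get_vec (dim orc) (nval b s) s \<Longrightarrow>
    run orc (Project a b r) s [ProjCall] (set_vec (dim orc) (nval r s) (project orc A y) s)"

inductive_cases run_SkipE: "run orc Skip s tr s'"
inductive_cases run_NStoreE: "run orc (NStore a e) s tr s'"
inductive_cases run_RStoreE: "run orc (RStore a e) s tr s'"
inductive_cases run_SeqE: "run orc (Seq c d) s tr s'"
inductive_cases run_CondE: "run orc (Cond b c d) s tr s'"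
inductive_cases run_WhileE: "run orc (While b c) s tr s'"
inductive_cases run_SeparateE: "run orc (Separate a r) s tr s'"
inductive_cases run_GradientE: "run orc (Gradient j a r) s tr s'"
inductive_cases run_ProjectE: "run orc (Project a b r) s tr s'"

lemma run_deterministic:
  "run orc c s tr s' \<Longrightarrow> run orc c s tr' s'' \<Longrightarrow> tr' = tr \<and> s'' = s'"
proof (induction arbitrary: tr' s'' rule: run.induct)
  case run_Skip then show ?case by (elim run_SkipE) simp
next
  case run_NStore then show ?case by (elim run_NStoreE) simp
next
  case run_RStore then show ?case by (elim run_RStoreE) simp
next
  case run_Seq then show ?case by (elim run_SeqE) blast
next
  case run_CondTrue then show ?case by (elim run_CondE) blast+
next
  case run_CondFalse then show ?case by (elim run_CondE) blast+
next
  case run_WhileFalse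
  show ?case by (rule run_WhileE[OF run_WhileFalse.prems]) (use run_WhileFalse.hyps in simp_all)
next
  case run_WhileTrue
  show ?case
    by (rule run_WhileE[OF run_WhileTrue.prems]) (use run_WhileTrue.hyps run_WhileTrue.IH in blast)+
next
  case run_Separate then show ?case by (elim run_SeparateE) simp
next
  case run_Gradient then show ?case by (elim run_GradientE) simp
next
  case run_Project then show ?case by (elim run_ProjectE) simp
qed

definition initial :: "nat \<Rightarrow> nat \<Rightarrow> real \<Rightarrow> real \<Rightarrow> memory" where
  "initial n m G \<epsilon> =
     \<lparr>nmem = (\<lambda>_. 0)(0 := n, 1 := m), rmem = (\<lambda>_. 0)(0 := G, 1 := \<epsilon>)\<rparr>"

text \<open>
  Result of a run: cell 0 of the memory of naturals tells whether the answer is a point (stored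
  from the address in cell 1) or a certificate (of length given by cell 1, its indices stored
  from the address in cell 2 and its points stored consecutively from the address in cell 3).
\<close>

definition result :: "nat \<Rightarrow> memory \<Rightarrow> answer" where
  "result n s =
     (if nmem s 0 = 0 then Solution (get_vec n (nmem s 1) s)
      else Infeasible (map (\<lambda>t. (nmem s (nmem s 2 + t), get_vec n (nmem s 3 + t * n) s))
             [0..<nmem s 1]))"

text \<open>
  A quantity is soft-O of \<open>x\<close> if it is bounded by \<open>soft_O C k x\<close> for constants \<open>C\<close> and \<open>k\<close>. The
  maximum only matters for \<open>x < 1\<close>: even then one oracle call is needed.
\<close>

definition soft_O :: "real \<Rightarrow> nat \<Rightarrow> real \<Rightarrow> real" where
  "soft_O C k x = C * max 1 x * (1 + ln (max 1 x)) ^ k"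

text \<open>
  Every part of a run containing no separation call uses at most one projection, at most one
  gradient and at most \<open>B\<close> units of time. This includes the parts before the first and after
  the last separation call.
\<close>

definition between_calls :: "event list \<Rightarrow> real \<Rightarrow> bool" where
  "between_calls tr B \<longleftrightarrow> (\<forall>us vs ws. tr = us @ vs @ ws \<longrightarrow> SepCall \<notin> set vs \<longrightarrow>
     count_list vs ProjCall \<le> 1 \<and> count_list vs GradCall \<le> 1 \<and> real (count_list vs Tick) \<le> B)"

end

theory Submission
  imports Defs "Jordan_Normal_Form.Determinant"
begin

text \<open>
  The algorithm is the online Newton step with the linearised violated constraints as losses. With
  \<open>a = nG + \<epsilon>\<close>, \<open>c = 1/(2G)\<close> and \<open>A\<^sub>T = aI + c \<Sum>\<^bsub>t<T\<^esub> g\<^sub>tg\<^sub>t\<^sup>\<top>\<close>, where \<open>g\<^sub>t\<close> is the gradient at \<open>x\<^sub>t\<close> of the constraint returned by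
  the separation oracle, the next point is the \<open>A\<^bsub>T+1\<^esub>\<close>-projection of \<open>x\<^sub>T - A\<^bsub>T+1\<^esub>\<^sup>-\<^sup>1g\<^sub>T\<close> onto the simplex.
  With \<open>s\<^sub>t = g\<^sub>t \<bullet> (x\<^sub>t - u)\<close>, the potential \<open>\<parallel>x\<^sub>T - u\<parallel>\<^sup>2\<close> in the norm of \<open>A\<^sub>T\<close> plus \<open>\<Sum>\<^bsub>t<T\<^esub> (2s\<^sub>t - cs\<^sub>t\<^sup>2)\<close> is bounded, for
  every \<open>u\<close> in the simplex, by \<open>R\<^sub>T = 2a + \<Sum>\<^bsub>t<T\<^esub> g\<^sub>t\<^sup>\<top>A\<^bsub>t+1\<^esub>\<^sup>-\<^sup>1g\<^sub>t\<close>. A point \<open>u\<close> satisfying all cuts has \<open>s\<^sub>t > \<epsilon>\<close>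
  and \<open>cs\<^sub>t \<le> 1\<close>, hence \<open>T\<epsilon> < R\<^sub>T\<close>; so as soon as \<open>R\<^sub>T \<le> T\<epsilon>\<close> the cuts certify infeasibility. The
  machine can maintain \<open>R\<^sub>T\<close> exactly, so this serves as its stopping rule and no logarithm is computed.
  Finally \<open>R\<^sub>T \<le> 2a + 2G ln (det A\<^sub>T / a\<^sup>n) \<le> 2a + 2nG ln (1 + T)\<close> by the matrix determinant lemma and
  Hadamard's inequality, which bounds the number of rounds.
\<close>

section \<open>Determinants of positive definite matrices\<close>

definition outer :: "nat \<Rightarrow> real vec \<Rightarrow> real vec \<Rightarrow> real mat" where
  "outer n u v = mat n n (\<lambda>(i, j). u $ i * v $ j)"

lemma outer_carrier [simp]: "outer n u v \<in> carrier_mat n n"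
  by (simp add: outer_def)

lemma outer_mult_vec:
  assumes "u \<in> carrier_vec n" "v \<in> carrier_vec n" "x \<in> carrier_vec n"
  shows "outer n u v *\<^sub>v x = (v \<bullet> x) \<cdot>\<^sub>v u"
  using assms by (intro eq_vecI)
    (auto simp: outer_def scalar_prod_def row_def sum_distrib_left ac_simps)

text \<open>Both orders of the triangular factors are covered, because
  \<open>det_one_plus_outer\<close> factors one block matrix as lower times upper and also as upper
  times lower.\<close>

lemma det_block_triangular_mult:
  fixes P :: "real mat"
  assumes "P \<in> carrier_mat n n" "L \<in> carrier_mat m n" "Q \<in> carrier_mat m m"
    and "P' \<in> carrier_mat n n" "R \<in> carrier_mat n m" "Q' \<in> carrier_mat m m"
  shows "det (four_block_mat P (0\<^sub>m n m) L Q * four_block_mat P' R (0\<^sub>m m n) Q') =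
      det P * det Q * (det P' * det Q')" (is "det (?X * ?Y) = _")
    and "det (four_block_mat P' R (0\<^sub>m m n) Q' * four_block_mat P (0\<^sub>m n m) L Q) =
      det P * det Q * (det P' * det Q')"
proof -
  have c: "?X \<in> carrier_mat (n + m) (n + m)" "?Y \<in> carrier_mat (n + m) (n + m)"
    using assms by (auto intro!: four_block_carrier_mat)
  have d: "det ?X = det P * det Q" "det ?Y = det P' * det Q'"
    using assms by (simp_all add: det_four_block_mat_upper_right_zero det_four_block_mat_lower_left_zero)
  show "det (?X * ?Y) = det P * det Q * (det P' * det Q')"
    "det (?Y * ?X) = det P * det Q * (det P' * det Q')"
    by (simp_all add: det_mult[OF c] det_mult[OF c(2,1)] d)
qed

text \<open>Sylvester's determinant identity for a column \<open>U\<close> and a row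
  \<open>V\<close>. The block matrix \<open>M\<close> can be eliminated from either diagonal block;
  the two Schur complements, \<open>1 + V * U\<close> of size 1 and \<open>1 + U * V\<close> of size
  \<open>n\<close>, both have determinant \<open>det M\<close>.\<close>

lemma det_one_plus_outer:
  assumes u: "u \<in> carrier_vec n" and v: "v \<in> carrier_vec n"
  shows "det (1\<^sub>m n + outer n u v) = 1 + v \<bullet> u"
proof -
  define U where "U = mat n 1 (\<lambda>(i, _). u $ i)"
  define V where "V = mat 1 n (\<lambda>(_, j). v $ j)"
  have c[simp]: "U \<in> carrier_mat n 1" "V \<in> carrier_mat 1 n" by (simp_all add: U_def V_def)
  have UV: "U * V = outer n u v"
    by (rule eq_matI) (auto simp: U_def V_def outer_def scalar_prod_def)
  have VU: "V * U = mat 1 1 (\<lambda>_. v \<bullet> u)"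
    using u v by (intro eq_matI) (auto simp: U_def V_def scalar_prod_def)
  define M where "M = four_block_mat (1\<^sub>m n) (- U) V (1\<^sub>m 1)"
  have "M = four_block_mat (1\<^sub>m n) (0\<^sub>m n 1) V (1\<^sub>m 1) *
      four_block_mat (1\<^sub>m n) (- U) (0\<^sub>m 1 n) (1\<^sub>m 1 + V * U)"
    unfolding M_def
    by (subst mult_four_block_mat[where ?nr1.0 = n and ?n1.0 = n and ?n2.0 = 1 and ?nr2.0 = 1
          and ?nc1.0 = n and ?nc2.0 = 1]) (auto intro!: cong_four_block_mat simp: U_def V_def scalar_prod_def)
  also have "det \<dots> = det (1\<^sub>m 1 + V * U)"
    by (subst det_block_triangular_mult) (auto intro!: add_carrier_mat mult_carrier_mat[where n = n] simp del: One_nat_def)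
  also have "\<dots> = 1 + v \<bullet> u" by (subst det_single) (auto simp: VU)
  finally have *: "det M = 1 + v \<bullet> u" .
  have "M = four_block_mat (1\<^sub>m n + U * V) (- U) (0\<^sub>m 1 n) (1\<^sub>m 1) *
      four_block_mat (1\<^sub>m n) (0\<^sub>m n 1) V (1\<^sub>m 1)"
    unfolding M_def
    by (subst mult_four_block_mat[where ?nr1.0 = n and ?n1.0 = n and ?n2.0 = 1 and ?nr2.0 = 1
          and ?nc1.0 = n and ?nc2.0 = 1]) (auto intro!: cong_four_block_mat simp: U_def V_def scalar_prod_def)
  also have "det \<dots> = det (1\<^sub>m n + U * V)"
    by (subst det_block_triangular_mult) (auto intro!: add_carrier_mat mult_carrier_mat[where n = 1] simp del: One_nat_def)
  finally show ?thesis using * by (simp add: UV)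
qed

definition pos_def :: "nat \<Rightarrow> real mat \<Rightarrow> bool" where
  "pos_def n A \<longleftrightarrow> A \<in> carrier_mat n n \<and> transpose_mat A = A \<and>
     (\<forall>v\<in>carrier_vec n. v \<noteq> 0\<^sub>v n \<longrightarrow> 0 < v \<bullet> (A *\<^sub>v v))"

lemma pos_def_diag_pos:
  assumes "pos_def n A" "i < n" shows "0 < A $$ (i, i)"
proof -
  have A: "A \<in> carrier_mat n n" using assms by (simp add: pos_def_def)
  have "unit_vec n i \<bullet> (A *\<^sub>v unit_vec n i) = A $$ (i, i)"
    using A assms(2) by (simp add: mult_mat_vec_def[symmetric])
  moreover have "unit_vec n i \<noteq> (0\<^sub>v n :: real vec)" using assms(2) by simp
  ultimately show ?thesis using assms by (metis pos_def_def unit_vec_carrier)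
qed

text \<open>Induction through the Schur complement \<open>S\<close> of the corner entry
  \<open>a\<close>. Elimination gives \<open>det A = a * det S\<close>, the matrix \<open>S\<close>
  is again positive definite, and each of its diagonal entries is one of \<open>A\<close> minus a
  square over \<open>a\<close>.\<close>

lemma hadamard_pos_def:
  "pos_def n A \<Longrightarrow> det A \<le> (\<Prod>i<n. A $$ (i, i))"
proof (induction n arbitrary: A)
  case 0
  then have "A \<in> carrier_mat 0 0" by (simp add: pos_def_def)
  then show ?case by (simp add: det_dim_zero)
next
  case (Suc n)
  have A: "A \<in> carrier_mat (Suc n) (Suc n)" and AT: "transpose_mat A = A"
    using Suc.prems by (simp_all add: pos_def_def)
  have sym: "A $$ (i, j) = A $$ (j, i)" if "i < Suc n" "j < Suc n" for i j
    using that A by (subst AT[symmetric]) simp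
  define a where "a = A $$ (0, 0)"
  have a: "0 < a" unfolding a_def by (rule pos_def_diag_pos[OF Suc.prems]) simp
  define S where "S = mat n n (\<lambda>(i, j). A $$ (Suc i, Suc j) - A $$ (Suc i, 0) * A $$ (0, Suc j) / a)"
  define r where "r = mat 1 n (\<lambda>(_, j). A $$ (0, Suc j))"
  define l where "l = mat n 1 (\<lambda>(i, _). A $$ (Suc i, 0) / a)"
  have c[simp]: "S \<in> carrier_mat n n" "r \<in> carrier_mat 1 n" "l \<in> carrier_mat n 1"
    by (simp_all add: S_def r_def l_def)
  have "A = four_block_mat (mat 1 1 (\<lambda>_. a)) r (mat n 1 (\<lambda>(i, _). A $$ (Suc i, 0)))
      (mat n n (\<lambda>(i, j). A $$ (Suc i, Suc j)))"
    using A by (intro eq_matI) (auto simp: a_def r_def)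
  also have "\<dots> = four_block_mat (1\<^sub>m 1) (0\<^sub>m 1 n) l (1\<^sub>m n) *
      four_block_mat (mat 1 1 (\<lambda>_. a)) r (0\<^sub>m n 1) S"
    using a
    by (subst mult_four_block_mat[where ?nr1.0 = 1 and ?n1.0 = 1 and ?n2.0 = n and ?nr2.0 = n
          and ?nc1.0 = 1 and ?nc2.0 = n])
       (auto intro!: cong_four_block_mat eq_matI simp: S_def r_def l_def scalar_prod_def)
  also have "det \<dots> = a * det S"
    by (subst det_block_triangular_mult) (auto simp: det_single simp del: One_nat_def)
  finally have det: "det A = a * det S" .
  have "pos_def n S"
    unfolding pos_def_def
  proof (intro conjI ballI impI)
    show "transpose_mat S = S" using sym by (intro eq_matI) (auto simp: S_def)
    fix x :: "real vec" assume x: "x \<in> carrier_vec n" and x0: "x \<noteq> 0\<^sub>v n"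
    \<comment> \<open>This first coordinate minimises the form of \<open>A\<close> for fixed
      \<open>x\<close>. It makes the first entry of \<open>A *\<^sub>v v\<close> vanish, so that the
      form of \<open>A\<close> at \<open>v\<close> equals that of \<open>S\<close> at
      \<open>x\<close>.\<close>
    define \<beta> where "\<beta> = - (\<Sum>j<n. A $$ (0, Suc j) * x $ j) / a"
    define v where "v = vCons \<beta> x"
    have v: "v \<in> carrier_vec (Suc n)" using x by (simp add: v_def)
    have "v \<noteq> 0\<^sub>v (Suc n)" using x0 by (simp add: v_def zero_vec_Suc)
    then have "0 < v \<bullet> (A *\<^sub>v v)" using Suc.prems v by (simp add: pos_def_def)
    also have "A *\<^sub>v v = vCons 0 (S *\<^sub>v x)"
    proof (rule eq_vecI)
      fix i assume "i < dim_vec (vCons 0 (S *\<^sub>v x))"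
      then have i: "i < Suc n" by (simp add: S_def)
      have "(A *\<^sub>v v) $ i = (\<Sum>j<Suc n. A $$ (i, j) * v $ j)"
        using i A v by (simp add: scalar_prod_def lessThan_atLeast0)
      also have "\<dots> = A $$ (i, 0) * \<beta> + (\<Sum>j<n. A $$ (i, Suc j) * x $ j)"
        using x by (subst sum.lessThan_Suc_shift) (simp add: v_def)
      also have "\<dots> = vCons 0 (S *\<^sub>v x) $ i"
      proof (cases i)
        case 0
        then show ?thesis using a by (simp add: \<beta>_def a_def)
      next
        case (Suc i')
        then have "(S *\<^sub>v x) $ i' = (\<Sum>j<n. (A $$ (i, Suc j) - A $$ (i, 0) * A $$ (0, Suc j) / a) * x $ j)"
          using i x by (simp add: S_def scalar_prod_def lessThan_atLeast0)
        then show ?thesis using Suc i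
          by (simp add: \<beta>_def S_def algebra_simps sum_subtractf sum_distrib_left sum_divide_distrib)
      qed
      finally show "(A *\<^sub>v v) $ i = vCons 0 (S *\<^sub>v x) $ i" .
    qed (use A in \<open>simp add: S_def\<close>)
    finally show "0 < x \<bullet> (S *\<^sub>v x)" by (simp add: v_def)
  qed simp
  then have IH: "det S \<le> (\<Prod>i<n. S $$ (i, i))" and pd: "\<And>i. i < n \<Longrightarrow> 0 < S $$ (i, i)"
    using Suc.IH pos_def_diag_pos by blast+
  have "(\<Prod>i<n. S $$ (i, i)) \<le> (\<Prod>i<n. A $$ (Suc i, Suc i))"
  proof (rule prod_mono)
    fix i assume i: "i \<in> {..<n}"
    then have "S $$ (i, i) = A $$ (Suc i, Suc i) - (A $$ (0, Suc i))\<^sup>2 / a"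
      using sym by (simp add: S_def power2_eq_square)
    then show "0 \<le> S $$ (i, i) \<and> S $$ (i, i) \<le> A $$ (Suc i, Suc i)"
      using pd[of i] i a by simp
  qed
  with IH have "det S \<le> (\<Prod>i<n. A $$ (Suc i, Suc i))" by linarith
  then show ?case using a unfolding det prod.lessThan_Suc_shift
    by (simp add: a_def)
qed

section \<open>The Newton step\<close>

text \<open>The matrix determinant lemma: factoring out \<open>A\<close> on the left leaves a rank
  one perturbation of the identity. The vector \<open>w\<close> stands for the inverse of
  \<open>A\<close> applied to \<open>g\<close>.\<close>

lemma det_rank_one_update:
  assumes A: "A \<in> carrier_mat n n" and w: "w \<in> carrier_vec n" and Aw: "A *\<^sub>v w = g"
  shows "det (A + c \<cdot>\<^sub>m outer n g g) = det A * (1 + c * (g \<bullet> w))"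
proof -
  have g: "g \<in> carrier_vec n" using A w by (simp flip: Aw)
  have "A + c \<cdot>\<^sub>m outer n g g = A * (1\<^sub>m n + outer n (c \<cdot>\<^sub>v w) g)" (is "_ = A * ?M")
  proof (rule eq_matI)
    fix i j assume "i < dim_row (A * ?M)" "j < dim_col (A * ?M)"
    then have ij: "i < n" "j < n" using A by (simp_all add: outer_def)
    have "(A * outer n (c \<cdot>\<^sub>v w) g) $$ (i, j) = c * (A *\<^sub>v w) $ i * g $ j"
      using A w g ij by (simp add: outer_def scalar_prod_def sum_distrib_left sum_distrib_right ac_simps)
    moreover have "A * ?M = A + A * outer n (c \<cdot>\<^sub>v w) g"
      using A by (simp add: mult_add_distrib_mat[where nc = n])
    ultimately show "(A + c \<cdot>\<^sub>m outer n g g) $$ (i, j) = (A * ?M) $$ (i, j)"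
      using A ij by (simp add: Aw outer_def)
  qed (use A in \<open>auto simp: outer_def\<close>)
  then show ?thesis
    using A w g by (simp add: det_mult[where n = n] det_one_plus_outer)
qed

section \<open>Quadratic forms and projections in a matrix norm\<close>

definition qform :: "real mat \<Rightarrow> real vec \<Rightarrow> real" where
  "qform A v = v \<bullet> (A *\<^sub>v v)"

lemma symmetric_scalar_prod:
  fixes A :: "real mat"
  assumes "A \<in> carrier_mat n n" "transpose_mat A = A" "u \<in> carrier_vec n" "v \<in> carrier_vec n"
  shows "u \<bullet> (A *\<^sub>v v) = v \<bullet> (A *\<^sub>v u)"
  using assms transpose_vec_mult_scalar[of A n n v u]
  by (metis comm_scalar_prod mult_mat_vec_carrier)

lemma qform_line:
  assumes A: "A \<in> carrier_mat n n" "transpose_mat A = A"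
    and v: "v \<in> carrier_vec n" and d: "d \<in> carrier_vec n"
  shows "qform A (v + t \<cdot>\<^sub>v d) = qform A v + 2 * t * (v \<bullet> (A *\<^sub>v d)) + t\<^sup>2 * qform A d"
proof -
  have "A *\<^sub>v (v + t \<cdot>\<^sub>v d) = A *\<^sub>v v + t \<cdot>\<^sub>v (A *\<^sub>v d)"
    using A v d by (simp add: mult_add_distrib_mat_vec mult_mat_vec)
  then have "qform A (v + t \<cdot>\<^sub>v d) = v \<bullet> (A *\<^sub>v v) + t * (v \<bullet> (A *\<^sub>v d)) +
      (t * (d \<bullet> (A *\<^sub>v v)) + t * (t * (d \<bullet> (A *\<^sub>v d))))"
    using A v d unfolding qform_def
    by (simp add: add_scalar_prod_distrib[where n = n] scalar_prod_add_distrib[where n = n] distrib_left)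
  then show ?thesis using symmetric_scalar_prod[OF A d v]
    by (simp add: qform_def power2_eq_square algebra_simps)
qed

lemma qform_uminus:
  assumes A: "A \<in> carrier_mat n n" "transpose_mat A = A"
    and u: "u \<in> carrier_vec n" and v: "v \<in> carrier_vec n"
  shows "qform A (u - v) = qform A (v - u)"
proof -
  have "u - v = 0\<^sub>v n + (-1) \<cdot>\<^sub>v (v - u)" using u v by (intro eq_vecI) auto
  then show ?thesis using qform_line[OF A, of "0\<^sub>v n" "v - u" "-1"] A u v
    by (simp add: qform_def)
qed

lemma simplex_carrier: "x \<in> simplex n \<Longrightarrow> x \<in> carrier_vec n"
  by (simp add: simplex_def)

lemma simplex_segment:
  assumes "x \<in> simplex n" "u \<in> simplex n" "0 \<le> t" "t \<le> 1"
  shows "x + t \<cdot>\<^sub>v (u - x) \<in> simplex n"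
proof -
  have "x $ i + t * (u $ i - x $ i) = (1 - t) * x $ i + t * u $ i" for i by (simp add: algebra_simps)
  then show ?thesis using assms
    by (auto simp: simplex_def sum.distrib simp flip: sum_distrib_left)
qed

text \<open>Optimality along the segment from \<open>z\<close> to \<open>u\<close> yields
  \<open>0 \<le> b\<close>. Then the form at \<open>u - y\<close> splits into the form at
  \<open>z - y\<close>, \<open>2 * b\<close> and the form at \<open>u - z\<close>, of which the
  first two are nonnegative. The argument applies to any minimiser, so it covers singular
  \<open>A\<close>.\<close>

lemma generalized_projection_contracts:
  assumes A: "pos_semidef n A" and y: "y \<in> carrier_vec n" and u: "u \<in> simplex n"
    and z: "generalized_projection (simplex n) A y z"
  shows "qform A (z - u) \<le> qform A (y - u)"
proof -
  have A': "A \<in> carrier_mat n n" "transpose_mat A = A" using A by (auto simp: pos_semidef_def)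
  have zS: "z \<in> simplex n" and min: "\<And>x. x \<in> simplex n \<Longrightarrow> qform A (z - y) \<le> qform A (x - y)"
    using z by (auto simp: generalized_projection_def is_arg_min_linorder qform_def)
  have c: "z \<in> carrier_vec n" "u \<in> carrier_vec n" using zS u by (auto simp: simplex_carrier)
  define b where "b = (z - y) \<bullet> (A *\<^sub>v (u - z))"
  define Q where "Q = qform A (u - z)"
  have Q0: "0 \<le> Q" using A c by (simp add: Q_def qform_def pos_semidef_def)
  \<comment> \<open>Minimality of \<open>z\<close> among the points of the segment, divided by
    \<open>t\<close>.\<close>
  have b: "0 \<le> 2 * b + t * Q" if t: "0 < t" "t \<le> 1" for t
  proof -
    have "z + t \<cdot>\<^sub>v (u - z) - y = (z - y) + t \<cdot>\<^sub>v (u - z)" using c y by (intro eq_vecI) auto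
    then have "qform A (z - y) \<le> qform A ((z - y) + t \<cdot>\<^sub>v (u - z))"
      using min[OF simplex_segment[OF zS u, of t]] t by simp
    also have "\<dots> = qform A (z - y) + 2 * t * b + t\<^sup>2 * Q"
      using qform_line[OF A'] c y by (simp add: b_def Q_def)
    finally have "0 \<le> t * (2 * b + t * Q)" by (simp add: algebra_simps power2_eq_square)
    then show ?thesis using t by (simp add: zero_le_mult_iff)
  qed
  have "0 \<le> b"
  proof (rule ccontr)
    assume "\<not> 0 \<le> b"
    then have bn: "b < 0" by simp
    \<comment> \<open>A negative \<open>b\<close> must dominate for small \<open>t\<close>: this
      choice gives \<open>t * Q \<le> - b\<close>. The summand 1 keeps the denominator positive when
      \<open>Q = 0\<close>.\<close>
    define t where "t = min 1 (- b / (Q + 1))"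
    have t: "0 < t" "t \<le> 1" using bn Q0 by (auto simp: t_def divide_neg_pos)
    have "t * Q \<le> - b / (Q + 1) * Q" using Q0 by (intro mult_right_mono) (auto simp: t_def)
    also have "\<dots> \<le> - b" using bn Q0 by (simp add: field_simps)
    finally show False using b[OF t] bn by linarith
  qed
  have "(z - y) + 1 \<cdot>\<^sub>v (u - z) = u - y" using c y by (intro eq_vecI) auto
  then have "qform A (u - y) = qform A (z - y) + 2 * b + Q"
    using qform_line[OF A', of "z - y" "u - z" 1] c y by (simp add: b_def Q_def)
  moreover have "0 \<le> qform A (z - y)" using A c y by (simp add: qform_def pos_semidef_def)
  ultimately have "Q \<le> qform A (u - y)" using \<open>0 \<le> b\<close> by linarith
  then show ?thesis
    using qform_uminus[OF A' c] qform_uminus[OF A' y c(2)] by (simp add: Q_def)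
qed

text \<open>\<open>B\<close> is the inverse of \<open>A\<close>, described by its action on vectors.
  The lower bound with constant \<open>a\<close> survives every rank one update; it makes
  \<open>A\<close> admissible for the projection oracle and positive definite for Hadamard's
  inequality. The positive determinant lets its logarithm be split.\<close>

definition newton_pair :: "nat \<Rightarrow> real \<Rightarrow> real mat \<Rightarrow> real mat \<Rightarrow> bool" where
  "newton_pair n a A B \<longleftrightarrow> A \<in> carrier_mat n n \<and> transpose_mat A = A \<and>
     (\<forall>v\<in>carrier_vec n. a * (v \<bullet> v) \<le> qform A v) \<and> 0 < det A \<and>
     B \<in> carrier_mat n n \<and> (\<forall>x\<in>carrier_vec n. A *\<^sub>v (B *\<^sub>v x) = x) \<and> transpose_mat B = B"

lemma scalar_prod_self_nonneg: "0 \<le> (v :: real vec) \<bullet> v"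
  by (simp add: scalar_prod_def sum_nonneg)

lemma newton_pair_pos_semidef:
  assumes "newton_pair n a A B" "0 \<le> a" shows "pos_semidef n A"
  unfolding pos_semidef_def
proof (intro conjI ballI)
  fix v :: "real vec" assume "v \<in> carrier_vec n"
  then have "a * (v \<bullet> v) \<le> qform A v" using assms by (simp add: newton_pair_def)
  moreover have "0 \<le> a * (v \<bullet> v)" using assms by (simp add: scalar_prod_self_nonneg)
  ultimately show "0 \<le> v \<bullet> (A *\<^sub>v v)" by (simp add: qform_def)
qed (use assms in \<open>auto simp: newton_pair_def\<close>)

lemma newton_pair_pos_def:
  assumes "newton_pair n a A B" "0 < a" shows "pos_def n A"
  unfolding pos_def_def
proof (intro conjI ballI impI)
  fix v :: "real vec" assume v: "v \<in> carrier_vec n" and v0: "v \<noteq> 0\<^sub>v n"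
  obtain i where i: "i < n" "v $ i \<noteq> 0" using v v0 by (metis carrier_vecD eq_vecI index_zero_vec)
  have "0 < v \<bullet> v" unfolding scalar_prod_def
    by (rule sum_pos2[of _ i]) (use i v in \<open>auto simp: zero_less_mult_iff\<close>)
  then have "0 < a * (v \<bullet> v)" using assms by simp
  also have "\<dots> \<le> qform A v" using assms v by (simp add: newton_pair_def)
  finally show "0 < v \<bullet> (A *\<^sub>v v)" by (simp add: qform_def)
qed (use assms in \<open>auto simp: newton_pair_def\<close>)

lemma transpose_smult: "transpose_mat (c \<cdot>\<^sub>m M) = c \<cdot>\<^sub>m transpose_mat M"
  by (rule eq_matI) auto

lemma newton_pair_init:
  assumes "0 < a" shows "newton_pair n a (a \<cdot>\<^sub>m 1\<^sub>m n) ((1 / a) \<cdot>\<^sub>m 1\<^sub>m n)"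
proof -
  have m: "(b \<cdot>\<^sub>m 1\<^sub>m n) *\<^sub>v v = b \<cdot>\<^sub>v v" if "v \<in> carrier_vec n" for v :: "real vec" and b
    using that by (intro eq_vecI) auto
  show ?thesis using assms
    by (auto simp: newton_pair_def qform_def m transpose_smult smult_smult_assoc)
qed

lemma outer_transpose: "transpose_mat (outer n v v) = outer n v v"
  by (rule eq_matI) (auto simp: outer_def)

lemma add_smult_mult_vec:
  fixes A :: "real mat"
  assumes "A \<in> carrier_mat n n" "M \<in> carrier_mat n n" "v \<in> carrier_vec n"
  shows "(A + c \<cdot>\<^sub>m M) *\<^sub>v v = A *\<^sub>v v + c \<cdot>\<^sub>v (M *\<^sub>v v)"
  using assms by (intro eq_vecI) (auto simp: add_scalar_prod_distrib[where n = n])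

lemma qform_rank_one_update:
  assumes "A \<in> carrier_mat n n" "g \<in> carrier_vec n" "v \<in> carrier_vec n"
  shows "qform (A + c \<cdot>\<^sub>m outer n g g) v = qform A v + c * (g \<bullet> v)\<^sup>2"
  using assms comm_scalar_prod[of g n v]
  by (simp add: qform_def add_smult_mult_vec outer_mult_vec scalar_prod_add_distrib[where n = n]
      power2_eq_square)

text \<open>The inverse is updated by the Sherman-Morrison formula. By the last claim the new
  inverse maps \<open>g\<close> to a multiple of \<open>w\<close>, so the Newton direction comes
  from the old inverse and no linear system is solved.\<close>

lemma newton_pair_update:
  assumes P: "newton_pair n a A B" and a: "0 \<le> a" and c: "0 \<le> c" and g: "g \<in> carrier_vec n"
  defines "w \<equiv> B *\<^sub>v g"
  defines "q \<equiv> g \<bullet> w"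
  defines "A' \<equiv> A + c \<cdot>\<^sub>m outer n g g"
  defines "B' \<equiv> B + (- (c / (1 + c * q))) \<cdot>\<^sub>m outer n w w"
  shows "0 \<le> q" and "newton_pair n a A' B'" and "det A' = det A * (1 + c * q)"
    and "A' *\<^sub>v ((1 / (1 + c * q)) \<cdot>\<^sub>v w) = g"
proof -
  have A: "A \<in> carrier_mat n n" and AT: "transpose_mat A = A"
    and lo: "\<And>v. v \<in> carrier_vec n \<Longrightarrow> a * (v \<bullet> v) \<le> qform A v" and d: "0 < det A"
    and B: "B \<in> carrier_mat n n" and AB: "\<And>x. x \<in> carrier_vec n \<Longrightarrow> A *\<^sub>v (B *\<^sub>v x) = x"
    and BT: "transpose_mat B = B"
    using P by (auto simp: newton_pair_def)
  have w: "w \<in> carrier_vec n" using B g by (simp add: w_def)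
  have Aw: "A *\<^sub>v w = g" using AB g by (simp add: w_def)
  have wg: "w \<bullet> g = q" using w g by (simp add: q_def comm_scalar_prod[of w n g])
  have "0 \<le> a * (w \<bullet> w)" using a by (simp add: scalar_prod_self_nonneg)
  with lo[OF w] show q: "0 \<le> q" by (simp add: qform_def Aw wg)
  then have cq: "0 < 1 + c * q" using c by (simp add: add_pos_nonneg)
  show det: "det A' = det A * (1 + c * q)"
    unfolding A'_def q_def by (rule det_rank_one_update[OF A w Aw])
  have A': "A' \<in> carrier_mat n n" and B': "B' \<in> carrier_mat n n" using A B by (auto simp: A'_def B'_def)
  have A'v: "A' *\<^sub>v v = A *\<^sub>v v + (c * (g \<bullet> v)) \<cdot>\<^sub>v g" if "v \<in> carrier_vec n" for v
    using that A g by (simp add: A'_def add_smult_mult_vec outer_mult_vec smult_smult_assoc)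
  have A'w: "A' *\<^sub>v w = (1 + c * q) \<cdot>\<^sub>v g"
    using A'v[OF w] g by (simp add: Aw q_def add_smult_distrib_vec)
  then show "A' *\<^sub>v ((1 / (1 + c * q)) \<cdot>\<^sub>v w) = g"
    using A' w cq g by (simp add: mult_mat_vec[OF A'] smult_smult_assoc)
  show "newton_pair n a A' B'"
    unfolding newton_pair_def
  proof (intro conjI ballI)
    show "transpose_mat A' = A'"
      using A AT by (simp add: A'_def transpose_add[where nr = n and nc = n] transpose_smult outer_transpose)
    show "transpose_mat B' = B'"
      using B BT by (simp add: B'_def transpose_add[where nr = n and nc = n] transpose_smult outer_transpose)
    show "0 < det A'" using det d cq by simp
    fix v :: "real vec" assume v: "v \<in> carrier_vec n"
    have "0 \<le> c * (g \<bullet> v)\<^sup>2" using c by simp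
    then show "a * (v \<bullet> v) \<le> qform A' v"
      using lo[OF v] by (simp add: A'_def qform_rank_one_update[OF A g v])
    \<comment> \<open>Symmetry of \<open>B\<close> moves it from \<open>v\<close> onto
      \<open>g\<close>.\<close>
    have gB: "g \<bullet> (B *\<^sub>v v) = w \<bullet> v"
      using symmetric_scalar_prod[OF B BT g v] B g v by (simp add: w_def comm_scalar_prod[of v n])
    have B'v: "B' *\<^sub>v v = B *\<^sub>v v + (- (c / (1 + c * q)) * (w \<bullet> v)) \<cdot>\<^sub>v w"
      using B v w by (simp add: B'_def add_smult_mult_vec outer_mult_vec smult_smult_assoc)
    have "A' *\<^sub>v (B' *\<^sub>v v) = A' *\<^sub>v (B *\<^sub>v v) + (- (c / (1 + c * q)) * (w \<bullet> v)) \<cdot>\<^sub>v (A' *\<^sub>v w)"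
      unfolding B'v using A' B v w by (simp add: mult_add_distrib_mat_vec mult_mat_vec)
    also have "\<dots> = v + (c * (w \<bullet> v)) \<cdot>\<^sub>v g + (- (c / (1 + c * q)) * (w \<bullet> v)) \<cdot>\<^sub>v ((1 + c * q) \<cdot>\<^sub>v g)"
      using A'v[of "B *\<^sub>v v"] B v by (simp add: AB gB A'w)
    \<comment> \<open>The two multiples of \<open>g\<close> cancel, because \<open>1 + c * q\<close>
      is positive.\<close>
    also have "\<dots> = v"
      using v g cq by (intro eq_vecI) auto
    finally show "A' *\<^sub>v (B' *\<^sub>v v) = v" .
  qed fact+
qed

lemma newton_step_potential:
  assumes P: "newton_pair n a A B" and a: "0 \<le> a" and c: "0 \<le> c" and g: "g \<in> carrier_vec n"
    and x: "x \<in> carrier_vec n" and u: "u \<in> simplex n"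
  defines "w \<equiv> B *\<^sub>v g"
  defines "q \<equiv> g \<bullet> w"
  defines "A' \<equiv> A + c \<cdot>\<^sub>m outer n g g"
  assumes z: "generalized_projection (simplex n) A' (x - (1 / (1 + c * q)) \<cdot>\<^sub>v w) z"
  shows "qform A' (z - u) + (2 * (g \<bullet> (x - u)) - c * (g \<bullet> (x - u))\<^sup>2)
    \<le> qform A (x - u) + q / (1 + c * q)"
proof -
  note up = newton_pair_update[OF P a c g, folded w_def, folded q_def, folded A'_def]
  have A: "A \<in> carrier_mat n n" and B: "B \<in> carrier_mat n n"
    and A': "A' \<in> carrier_mat n n" "transpose_mat A' = A'"
    using P up(2) by (auto simp: newton_pair_def)
  have w: "w \<in> carrier_vec n" using B g by (simp add: w_def)
  have uc: "u \<in> carrier_vec n" using u by (rule simplex_carrier)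
  define p where "p = (1 / (1 + c * q)) \<cdot>\<^sub>v w"
  have p: "p \<in> carrier_vec n" using w by (simp add: p_def)
  have A'p: "A' *\<^sub>v p = g" using up(4) by (simp add: p_def)
  have pg: "p \<bullet> g = q / (1 + c * q)"
    using w g by (simp add: p_def q_def comm_scalar_prod[of w n g])
  have "qform A' (z - u) \<le> qform A' (x - p - u)"
    using z u x p unfolding p_def[symmetric]
    by (intro generalized_projection_contracts[OF newton_pair_pos_semidef[OF up(2) a]]) auto
  also have "x - p - u = (x - u) + (- 1) \<cdot>\<^sub>v p" using x p uc by (intro eq_vecI) auto
  also have "qform A' \<dots> = qform A' (x - u) - 2 * ((x - u) \<bullet> g) + p \<bullet> g"
    using qform_line[OF A', of "x - u" p "-1"] x uc p by (simp add: A'p qform_def)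
  also have "qform A' (x - u) = qform A (x - u) + c * (g \<bullet> (x - u))\<^sup>2"
    using x uc by (simp add: A'_def qform_rank_one_update[OF A g])
  also have "(x - u) \<bullet> g = g \<bullet> (x - u)" using x uc g by (simp add: comm_scalar_prod[of g n])
  finally show ?thesis by (simp add: pg)
qed

section \<open>Regret and the number of rounds\<close>

text \<open>All entries lie between 0 and 1, hence each squared difference is at most the sum of the
  two entries, and these sums add up to 2.\<close>

lemma simplex_diff_scalar_prod_self:
  assumes "x \<in> simplex n" "u \<in> simplex n"
  shows "(x - u) \<bullet> (x - u) \<le> 2"
proof -
  have le1: "y $ i \<le> 1" if "y \<in> simplex n" "i < n" for y i
    using that member_le_sum[of i "{..<n}" "($) y"] by (auto simp: simplex_def)
  have d: "dim_vec u = n" using assms by (auto simp: simplex_def)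
  have "(x - u) \<bullet> (x - u) = (\<Sum>i<n. (x $ i - u $ i)\<^sup>2)"
    using d by (simp add: scalar_prod_def lessThan_atLeast0 power2_eq_square)
  also have "\<dots> \<le> (\<Sum>i<n. x $ i + u $ i)"
  proof (rule sum_mono)
    fix i assume "i \<in> {..<n}"
    then have i: "0 \<le> x $ i" "x $ i \<le> 1" "0 \<le> u $ i" "u $ i \<le> 1"
      using assms le1 by (auto simp: simplex_def)
    have "x $ i * x $ i \<le> x $ i" "u $ i * u $ i \<le> u $ i" "0 \<le> x $ i * u $ i"
      using i by (simp_all add: mult_left_le)
    then show "(x $ i - u $ i)\<^sup>2 \<le> x $ i + u $ i"
      by (simp add: power2_eq_square algebra_simps)
  qed
  also have "\<dots> = 2" using assms by (simp add: simplex_def sum.distrib)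
  finally show ?thesis .
qed

lemma unit_vec_in_simplex: "0 < n \<Longrightarrow> unit_vec n 0 \<in> simplex n"
  by (simp add: simplex_def unit_vec_def sum.delta)

text \<open>This is \<open>ln y \<le> y - 1\<close> at \<open>y = 1 / (1 + z)\<close>. It bounds an
  increment of the threshold by the growth of the log determinant.\<close>

lemma ln_1p_ge_ratio:
  assumes "0 \<le> (z :: real)" shows "z / (1 + z) \<le> ln (1 + z)"
proof -
  have "ln (inverse (1 + z)) \<le> inverse (1 + z) - 1" using assms by (intro ln_le_minus_one) simp
  moreover have "inverse (1 + z) - 1 = - (z / (1 + z))" using assms by (simp add: field_simps)
  ultimately show ?thesis using assms by (simp add: ln_inverse)
qed

text \<open>The logarithm lies below its tangent at \<open>4 * X\<close>. There the slope times
  \<open>2 * X\<close> is 1/2, so half of \<open>T\<close> can be absorbed on the left.\<close>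

lemma self_bounding_log:
  assumes X: "1 \<le> (X :: real)" and T: "0 \<le> T" and le: "T < 4 * X + 2 * X * ln (1 + T)"
  shows "T < 8 * X + 1 + 4 * X * ln (4 * X)"
proof -
  have "ln ((1 + T) / (4 * X)) \<le> (1 + T) / (4 * X) - 1" using X T by (intro ln_le_minus_one) simp
  then have "ln (1 + T) \<le> (1 + T) / (4 * X) + ln (4 * X)" using X T by (simp add: ln_div)
  then have "2 * X * ln (1 + T) \<le> 2 * X * ((1 + T) / (4 * X) + ln (4 * X))"
    using X by (intro mult_left_mono) auto
  also have "\<dots> = (1 + T) / 2 + 2 * X * ln (4 * X)" using X by (simp add: field_simps)
  finally have "2 * X * ln (1 + T) \<le> (1 + T) / 2 + 2 * X * ln (4 * X)" .
  moreover define K where "K = 2 * X * ln (4 * X)"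
  ultimately have "T < 8 * X + 1 + 2 * K" using le by argo
  then show ?thesis by (simp add: K_def)
qed

section \<open>The regret invariant, the certificate and the number of rounds\<close>

locale feasibility_instance =
  fixes n m :: nat and f :: "nat \<Rightarrow> real vec \<Rightarrow> real" and df :: "nat \<Rightarrow> real vec \<Rightarrow> real vec"
    and G \<epsilon> :: real and sep :: "real vec \<Rightarrow> nat option" and proj :: "real mat \<Rightarrow> real vec \<Rightarrow> real vec"
  assumes n: "1 \<le> n" and m: "1 \<le> m" and program: "convex_program n m f df"
    and gradient_bound: "\<And>j x. j < m \<Longrightarrow> x \<in> simplex n \<Longrightarrow> l2norm (df j x) \<le> G"
    and eps: "0 < \<epsilon>" and sep: "separation_oracle n m f \<epsilon> sep" and proj: "projection_oracle n proj"
begin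

lemma G_nonneg: "0 \<le> G"
  using gradient_bound[of 0 "unit_vec n 0"] l2norm_nonneg[of "df 0 (unit_vec n 0)"] m n
    unit_vec_in_simplex[of n] by simp

text \<open>If \<open>G = 0\<close> then \<open>step\<close> is the junk value 0, which is harmless because all gradients vanish.\<close>

definition reg :: real where "reg = real n * G + \<epsilon>"
definition step :: real where "step = 1 / (2 * G)"

text \<open>The summand \<open>\<epsilon>\<close> keeps the regularisation positive even when
  \<open>G = 0\<close>.\<close>

lemma reg_pos: "0 < reg" using G_nonneg eps by (simp add: reg_def add_nonneg_pos)
lemma step_nonneg: "0 \<le> step" using G_nonneg by (simp add: step_def)

lemma gradient_carrier: "j < m \<Longrightarrow> x \<in> simplex n \<Longrightarrow> df j x \<in> carrier_vec n"
  using program by (auto simp: convex_program_def has_gradient_def)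

lemma gradient_sq_le:
  assumes "j < m" "x \<in> simplex n" shows "df j x \<bullet> df j x \<le> G\<^sup>2"
proof -
  have "(l2norm (df j x))\<^sup>2 \<le> G\<^sup>2"
    using gradient_bound[OF assms] l2norm_nonneg by (intro power_mono)
  then show ?thesis by (simp add: l2norm_def scalar_prod_self_nonneg)
qed

lemma gradient_zero:
  assumes "G = 0" "j < m" "x \<in> simplex n" shows "df j x = 0\<^sub>v n"
proof -
  note g = gradient_carrier[OF assms(2,3)]
  have "(\<Sum>i<n. (df j x $ i)\<^sup>2) \<le> 0" using gradient_sq_le[OF assms(2,3)] assms(1) g
    by (simp add: scalar_prod_def lessThan_atLeast0 power2_eq_square)
  then have "(\<Sum>i<n. (df j x $ i)\<^sup>2) = 0" by (intro antisym sum_nonneg) auto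
  then show ?thesis using g by (intro eq_vecI) (auto simp: sum_nonneg_eq_0_iff)
qed

text \<open>A form of Cauchy-Schwarz: expanding the square of
  \<open>df j x - G \<cdot>\<^sub>v d\<close>, with the squared distance at most 2, bounds the
  product by \<open>3 * G / 2\<close>.\<close>

lemma gradient_diff_le:
  assumes j: "j < m" and x: "x \<in> simplex n" and u: "u \<in> simplex n"
  shows "df j x \<bullet> (x - u) \<le> 2 * G"
proof (cases "G = 0")
  case True
  then show ?thesis using gradient_zero[OF True j x] x u by (auto simp: simplex_def)
next
  case False
  then have G: "0 < G" using G_nonneg by simp
  note g = gradient_carrier[OF j x]
  define d where "d = x - u"
  have d: "d \<in> carrier_vec n" using x u by (auto simp: d_def simplex_carrier)
  have "0 \<le> (df j x - G \<cdot>\<^sub>v d) \<bullet> (df j x - G \<cdot>\<^sub>v d)" by (rule scalar_prod_self_nonneg)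
  also have "\<dots> = df j x \<bullet> df j x - G * (df j x \<bullet> d) - (G * (d \<bullet> df j x) - G * (G * (d \<bullet> d)))"
    using g d by (simp add: minus_scalar_prod_distrib[where n = n] scalar_prod_minus_distrib[where n = n] right_diff_distrib)
  also have "d \<bullet> df j x = df j x \<bullet> d" using g d by (simp add: comm_scalar_prod[of d n])
  also have "df j x \<bullet> df j x - G * (df j x \<bullet> d) - (G * (df j x \<bullet> d) - G * (G * (d \<bullet> d)))
      = df j x \<bullet> df j x - 2 * G * (df j x \<bullet> d) + G\<^sup>2 * (d \<bullet> d)"
    by (simp add: power2_eq_square)
  also have "\<dots> \<le> G\<^sup>2 - 2 * G * (df j x \<bullet> d) + G\<^sup>2 * 2"
    using gradient_sq_le[OF j x] simplex_diff_scalar_prod_self[OF x u]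
    by (intro add_mono diff_mono mult_left_mono) (use G in \<open>auto simp: d_def\<close>)
  finally have "G * (2 * (df j x \<bullet> d)) \<le> G * (3 * G)"
    by (simp add: power2_eq_square algebra_simps)
  then show ?thesis using G by (simp add: d_def)
qed

text \<open>The contribution of one round to the potential at \<open>u\<close>. The square is the
  change of the norm caused by the rank one update.\<close>

definition gap :: "nat \<Rightarrow> real vec \<Rightarrow> real vec \<Rightarrow> real" where
  "gap j x u = 2 * (df j x \<bullet> (x - u)) - step * (df j x \<bullet> (x - u))\<^sup>2"

text \<open>With \<open>s\<close> the product in \<open>gap\<close>, the cut forces
  \<open>\<epsilon> < s\<close>, and \<open>s \<le> 2 * G\<close> means
  \<open>step * s \<le> 1\<close>. So the square costs at most one of the two copies of
  \<open>s\<close>.\<close>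

lemma gap_gt:
  assumes j: "j < m" and x: "x \<in> simplex n" and u: "u \<in> simplex n" and f: "\<epsilon> < f j x"
    and cut: "f j x + df j x \<bullet> (u - x) \<le> 0"
  shows "\<epsilon> < gap j x u"
proof -
  note g = gradient_carrier[OF j x]
  have c: "x \<in> carrier_vec n" "u \<in> carrier_vec n" using x u by (auto simp: simplex_carrier)
  define s where "s = df j x \<bullet> (x - u)"
  have "df j x \<bullet> (u - x) = - s"
    using g c by (simp add: s_def scalar_prod_minus_distrib[where n = n])
  then have s: "\<epsilon> < s" using f cut by simp
  have "s \<le> 2 * G" unfolding s_def by (rule gradient_diff_le[OF j x u])
  then have "step * s \<le> 1" using s eps by (simp add: step_def divide_le_eq)
  then have "step * s * s \<le> 1 * s" using s eps by (intro mult_right_mono) auto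
  then show ?thesis using s by (simp add: gap_def s_def[symmetric] power2_eq_square)
qed

text \<open>\<open>R\<close> is the threshold kept by the machine. Its lower bound rules out
  acceptance of an empty certificate, its upper bound limits the number of rounds, and the diagonal
  bound feeds Hadamard's inequality. The whole history \<open>js\<close>, \<open>xs\<close> is
  included since it becomes the certificate.\<close>

definition ons_inv :: "nat \<Rightarrow> real mat \<Rightarrow> real mat \<Rightarrow> real \<Rightarrow> (nat \<Rightarrow> nat) \<Rightarrow> (nat \<Rightarrow> real vec) \<Rightarrow> bool" where
  "ons_inv T A B R js xs \<longleftrightarrow> newton_pair n reg A B \<and>
     (\<forall>t<T. js t < m \<and> \<epsilon> < f (js t) (xs t)) \<and> (\<forall>t\<le>T. xs t \<in> simplex n) \<and>
     (\<forall>u\<in>simplex n. qform A (xs T - u) + (\<Sum>t<T. gap (js t) (xs t) u) \<le> R) \<and>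
     2 * reg \<le> R \<and> R \<le> 2 * reg + 2 * G * ln (det A / reg ^ n) \<and>
     (\<forall>i<n. A $$ (i, i) \<le> reg + real T * (G / 2))"

text \<open>The threshold starts at \<open>reg\<close> times 2, the bound on squared distances in
  the simplex.\<close>

lemma ons_inv_init:
  assumes "xs 0 = unit_vec n 0"
  shows "ons_inv 0 (reg \<cdot>\<^sub>m 1\<^sub>m n) ((1 / reg) \<cdot>\<^sub>m 1\<^sub>m n) (2 * reg) js xs"
proof -
  have "qform (reg \<cdot>\<^sub>m 1\<^sub>m n) (unit_vec n 0 - u) \<le> 2 * reg" if u: "u \<in> simplex n" for u
  proof -
    have "(reg \<cdot>\<^sub>m 1\<^sub>m n) *\<^sub>v v = reg \<cdot>\<^sub>v v" if "v \<in> carrier_vec n" for v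
      using that by (intro eq_vecI) auto
    moreover have "unit_vec n 0 - u \<in> carrier_vec n" using u by (auto simp: simplex_carrier)
    ultimately have "qform (reg \<cdot>\<^sub>m 1\<^sub>m n) (unit_vec n 0 - u) =
        reg * ((unit_vec n 0 - u) \<bullet> (unit_vec n 0 - u))" by (simp add: qform_def)
    also have "\<dots> \<le> reg * 2"
      using reg_pos n u by (intro mult_left_mono simplex_diff_scalar_prod_self[of _ n] unit_vec_in_simplex) auto
    finally show ?thesis by simp
  qed
  then show ?thesis using reg_pos n
    by (simp add: ons_inv_def assms newton_pair_init unit_vec_in_simplex)
qed

text \<open>The new history is a separate pair of functions that agrees with the old one on the
  past, because it will be read from a changed memory. Admissibility of the projection call is part
  of the conclusion.\<close>

lemma ons_inv_step:
  assumes I: "ons_inv T A B R js xs"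
    and j: "js' T < m" "\<epsilon> < f (js' T) (xs T)"
    and js': "\<And>t. t < T \<Longrightarrow> js' t = js t" and xs': "\<And>t. t \<le> T \<Longrightarrow> xs' t = xs t"
  defines "g \<equiv> df (js' T) (xs T)"
  defines "w \<equiv> B *\<^sub>v g"
  defines "q \<equiv> g \<bullet> w"
  defines "A' \<equiv> A + step \<cdot>\<^sub>m outer n g g"
  assumes z: "xs' (Suc T) = proj A' (xs T - (1 / (1 + step * q)) \<cdot>\<^sub>v w)"
  shows "ons_inv (Suc T) A' (B + (- (step / (1 + step * q))) \<cdot>\<^sub>m outer n w w)
    (R + q / (1 + step * q)) js' xs'"
    and "pos_semidef n A'" and "xs' (Suc T) \<in> simplex n"
proof -
  have P: "newton_pair n reg A B" and x: "xs T \<in> simplex n" using I by (auto simp: ons_inv_def)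
  have xc: "xs T \<in> carrier_vec n" using x by (rule simplex_carrier)
  have g: "g \<in> carrier_vec n" unfolding g_def by (rule gradient_carrier[OF j(1) x])
  note a = less_imp_le[OF reg_pos] and c = step_nonneg
  note up = newton_pair_update[OF P a c g, folded w_def, folded q_def, folded A'_def]
  show psd: "pos_semidef n A'" by (rule newton_pair_pos_semidef[OF up(2) a])
  have w: "w \<in> carrier_vec n" using P g by (auto simp: w_def newton_pair_def)
  have z': "generalized_projection (simplex n) A' (xs T - (1 / (1 + step * q)) \<cdot>\<^sub>v w) (xs' (Suc T))"
    using proj psd xc w unfolding z projection_oracle_def by simp
  then show zS: "xs' (Suc T) \<in> simplex n"
    by (auto simp: generalized_projection_def is_arg_min_linorder)
  define r where "r = q / (1 + step * q)"
  have r0: "0 \<le> r" using up(1) c by (simp add: r_def)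
  have cq: "0 \<le> step * q" using up(1) c by simp
  \<comment> \<open>The threshold grows by no more than \<open>2 * G\<close> times the growth of the
    log determinant. If \<open>G = 0\<close> the gradient vanishes and both sides are 0.\<close>
  have "r \<le> 2 * G * ln (1 + step * q)"
  proof (cases "G = 0")
    case True
    have "g = 0\<^sub>v n" unfolding g_def by (rule gradient_zero[OF True j(1) x])
    then show ?thesis using True w by (simp add: r_def q_def)
  next
    case False
    then have G: "0 < G" using G_nonneg by simp
    have "r = 2 * G * (step * q / (1 + step * q))" using G by (simp add: r_def step_def)
    also have "\<dots> \<le> 2 * G * ln (1 + step * q)"
      using G cq by (intro mult_left_mono ln_1p_ge_ratio) auto
    finally show ?thesis .
  qed
  also have "ln (1 + step * q) = ln (det A' / reg ^ n) - ln (det A / reg ^ n)"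
    using P cq reg_pos unfolding up(3) by (simp add: newton_pair_def ln_div ln_mult)
  finally have r1: "r \<le> 2 * G * ln (det A' / reg ^ n) - 2 * G * ln (det A / reg ^ n)"
    by (simp add: right_diff_distrib)
  have "qform A' (xs' (Suc T) - u) + (\<Sum>t<Suc T. gap (js' t) (xs' t) u) \<le> R + r"
    if u: "u \<in> simplex n" for u
  proof -
    have "qform A' (xs' (Suc T) - u) + gap (js' T) (xs T) u \<le> qform A (xs T - u) + r"
      using newton_step_potential[OF P a c g xc u, folded w_def, folded q_def, folded A'_def, OF z']
      by (simp add: gap_def g_def r_def)
    moreover have "qform A (xs T - u) + (\<Sum>t<T. gap (js t) (xs t) u) \<le> R"
      using I u by (simp add: ons_inv_def)
    ultimately show ?thesis using js' xs' by simp
  qed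
  moreover have "A' $$ (i, i) \<le> reg + real (Suc T) * (G / 2)" if i: "i < n" for i
  proof -
    have "(g $ i)\<^sup>2 \<le> (\<Sum>i<n. (g $ i)\<^sup>2)" using i by (intro member_le_sum) auto
    also have "\<dots> = g \<bullet> g" using g by (simp add: scalar_prod_def lessThan_atLeast0 power2_eq_square)
    also have "\<dots> \<le> G\<^sup>2" unfolding g_def by (rule gradient_sq_le[OF j(1) x])
    finally have "step * (g $ i)\<^sup>2 \<le> step * G\<^sup>2" using c by (intro mult_left_mono)
    \<comment> \<open>For \<open>G = 0\<close> this holds by the convention that division by 0 gives
      0.\<close>
    also have "\<dots> = G / 2" by (simp add: step_def power2_eq_square)
    finally have "step * (g $ i)\<^sup>2 \<le> G / 2" .
    moreover have "A $$ (i, i) \<le> reg + real T * (G / 2)" using I i by (simp add: ons_inv_def)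
    moreover have "A' $$ (i, i) = A $$ (i, i) + step * (g $ i)\<^sup>2"
      using i P by (simp add: A'_def outer_def newton_pair_def power2_eq_square)
    ultimately have "A' $$ (i, i) \<le> reg + real T * (G / 2) + G / 2" by linarith
    then show ?thesis by (simp add: algebra_simps add_divide_distrib)
  qed
  moreover have "xs' t \<in> simplex n" if "t \<le> Suc T" for t
    using that I zS xs' by (cases "t = Suc T") (auto simp: ons_inv_def)
  moreover have "js' t < m \<and> \<epsilon> < f (js' t) (xs' t)" if "t < Suc T" for t
    using that I j js' xs' by (cases "t = T") (auto simp: ons_inv_def less_Suc_eq)
  moreover have "2 * reg \<le> R + r" "R + r \<le> 2 * reg + 2 * G * ln (det A' / reg ^ n)"
    using I r0 r1 by (auto simp: ons_inv_def)
  ultimately show "ons_inv (Suc T) A' (B + (- (step / (1 + step * q))) \<cdot>\<^sub>m outer n w w)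
      (R + q / (1 + step * q)) js' xs'"
    using up(2) by (simp add: ons_inv_def r_def)
qed

text \<open>If some \<open>u\<close> satisfied all cuts, each gap would exceed
  \<open>\<epsilon>\<close> and their sum would exceed \<open>real T * \<epsilon>\<close>, hence
  \<open>R\<close>. The potential inequality forbids this, its quadratic term being
  nonnegative.\<close>

lemma ons_certificate:
  assumes I: "ons_inv T A B R js xs" and R: "R \<le> real T * \<epsilon>"
  shows "infeasibility_proof n m f df (map (\<lambda>t. (js t, xs t)) [0..<T])"
  unfolding infeasibility_proof_def
proof (intro conjI ballI)
  show "case p of (j, x) \<Rightarrow> j < m \<and> x \<in> simplex n" if "p \<in> set (map (\<lambda>t. (js t, xs t)) [0..<T])" for p
    using that I by (auto simp: ons_inv_def)
  fix u assume u: "u \<in> simplex n"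
  \<comment> \<open>A nonempty sum is required for the strict inequality below.\<close>
  have T: "0 < T" using I R reg_pos by (intro gr0I) (auto simp: ons_inv_def)
  have "\<exists>t<T. f (js t) (xs t) + df (js t) (xs t) \<bullet> (u - xs t) > 0"
  proof (rule ccontr)
    assume "\<not> ?thesis"
    then have "\<epsilon> < gap (js t) (xs t) u" if "t < T" for t
      using that I u by (intro gap_gt) (auto simp: ons_inv_def not_less dest: leD)
    then have "(\<Sum>t<T. \<epsilon>) < (\<Sum>t<T. gap (js t) (xs t) u)"
      using T by (intro sum_strict_mono) auto
    moreover have "0 \<le> qform A (xs T - u)"
      using newton_pair_pos_semidef[of n reg A B] reg_pos I u
      by (auto simp: ons_inv_def pos_semidef_def qform_def simplex_carrier)
    moreover have "qform A (xs T - u) + (\<Sum>t<T. gap (js t) (xs t) u) \<le> R"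
      using I u by (simp add: ons_inv_def)
    ultimately show False using R by simp
  qed
  then show "\<exists>(j, x)\<in>set (map (\<lambda>t. (js t, xs t)) [0..<T]). f j x + df j x \<bullet> (u - x) > 0"
    by fastforce
qed

definition ratio :: real where "ratio = max 1 (real n * G / \<epsilon>)"

text \<open>While the stopping test fails, \<open>real T * \<epsilon>\<close> stays below the
  logarithmic bound on \<open>R\<close>. Hadamard turns the determinant into
  \<open>(1 + real T) ^ n\<close>, and the resulting inequality bounds \<open>T\<close> by itself
  only logarithmically.\<close>

lemma ons_step_bound:
  assumes I: "ons_inv T A B R js xs" and R: "real T * \<epsilon> < R"
  shows "real T < 8 * ratio + 1 + 4 * ratio * ln (4 * ratio)"
proof (rule self_bounding_log)
  have P: "newton_pair n reg A B" using I by (simp add: ons_inv_def)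
  have pd: "pos_def n A" by (rule newton_pair_pos_def[OF P reg_pos])
  \<comment> \<open>As \<open>1 \<le> n\<close>, the gain \<open>G / 2\<close> per round is at most
    \<open>reg\<close>, so every diagonal entry is at most
    \<open>reg * (1 + real T)\<close>.\<close>
  have "real T * (G / 2) \<le> real T * reg"
    using G_nonneg eps n mult_right_mono[of 1 "real n" G] by (intro mult_left_mono) (auto simp: reg_def)
  then have "A $$ (i, i) \<le> reg * (1 + real T)" if "i < n" for i
    using I that by (auto simp: ons_inv_def algebra_simps intro: order_trans)
  then have "(\<Prod>i<n. A $$ (i, i)) \<le> (\<Prod>i<n. reg * (1 + real T))"
    using pos_def_diag_pos[OF pd] by (intro prod_mono) (auto simp: less_imp_le)
  then have "det A / reg ^ n \<le> (1 + real T) ^ n"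
    using hadamard_pos_def[OF pd] reg_pos by (simp add: power_mult_distrib divide_le_eq ac_simps)
  then have "ln (det A / reg ^ n) \<le> ln ((1 + real T) ^ n)"
    using P reg_pos by (intro ln_mono) (auto simp: newton_pair_def)
  then have "2 * G * ln (det A / reg ^ n) \<le> 2 * G * (real n * ln (1 + real T))"
    using G_nonneg by (intro mult_left_mono) (auto simp: ln_realpow)
  then have "real T * \<epsilon> < 2 * reg + 2 * G * (real n * ln (1 + real T))"
    using I R by (simp add: ons_inv_def)
  then have "real T < (2 * reg + 2 * G * (real n * ln (1 + real T))) / \<epsilon>"
    using eps by (simp add: less_divide_eq)
  also have "\<dots> = 2 * (real n * G / \<epsilon>) + 2 + 2 * (real n * G / \<epsilon>) * ln (1 + real T)"
    using eps by (simp add: reg_def add_divide_distrib algebra_simps)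
  \<comment> \<open>The summand 2 comes from the \<open>\<epsilon>\<close> in \<open>reg\<close> and
    is absorbed using \<open>1 \<le> ratio\<close>.\<close>
  also have "\<dots> \<le> 2 * ratio + 2 * ratio + 2 * ratio * ln (1 + real T)"
    by (intro add_mono mult_mono) (use G_nonneg eps in \<open>auto simp: ratio_def\<close>)
  finally show "real T < 4 * ratio + 2 * ratio * ln (1 + real T)" by simp
qed (auto simp: ratio_def)

end

section \<open>Timed runs and array loops\<close>

notation Seq (infixr ";;" 60)

abbreviation mem :: "(nat \<Rightarrow> nat) \<Rightarrow> (nat \<Rightarrow> real) \<Rightarrow> memory" where
  "mem nm r \<equiv> \<lparr>nmem = nm, rmem = r\<rparr>"

text \<open>Only ticks are allowed in the trace, so such a run makes no oracle call. An upper bound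
  in place of an exact count lets branches of different lengths share one budget.\<close>

definition timed :: "oracles \<Rightarrow> com \<Rightarrow> memory \<Rightarrow> nat \<Rightarrow> memory \<Rightarrow> bool" where
  "timed orc c s K s' \<longleftrightarrow> (\<exists>k\<le>K. run orc c s (replicate k Tick) s')"

lemma timed_Seq:
  assumes "timed orc c s K s'" "timed orc d s' K' s''" "K + K' \<le> K''"
  shows "timed orc (c ;; d) s K'' s''"
proof -
  obtain k k' where "k \<le> K" "run orc c s (replicate k Tick) s'"
    "k' \<le> K'" "run orc d s' (replicate k' Tick) s''"
    using assms by (auto simp: timed_def)
  then have "run orc (c ;; d) s (replicate (k + k') Tick) s''" "k + k' \<le> K''"
    using assms(3) by (auto simp: replicate_add intro: run_Seq)
  then show ?thesis unfolding timed_def by blast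
qed

lemma timed_mono: "timed orc c s K s' \<Longrightarrow> K \<le> K' \<Longrightarrow> timed orc c s K' s'"
  unfolding timed_def using le_trans by blast

lemma timed_Skip: "timed orc Skip s 1 s"
  unfolding timed_def by (rule exI[of _ 1]) (simp add: run_Skip)

lemma timed_NStore:
  "nval a (mem nm r) = x \<Longrightarrow> nval e (mem nm r) = y \<Longrightarrow>
    timed orc (NStore a e) (mem nm r) 1 (mem (nm(x := y)) r)"
  unfolding timed_def using run_NStore[of orc a e "mem nm r"]
  by (intro exI[of _ 1]) (simp add: set_nmem_def)

lemma timed_RStore:
  "nval a (mem nm r) = x \<Longrightarrow> rval e (mem nm r) = y \<Longrightarrow>
    timed orc (RStore a e) (mem nm r) 1 (mem nm (r(x := y)))"
  unfolding timed_def using run_RStore[of orc a e "mem nm r"]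
  by (intro exI[of _ 1]) (simp add: set_rmem_def)

lemma timed_Cond:
  assumes "timed orc (if bval b s then c else d) s K s'"
  shows "timed orc (Cond b c d) s (Suc K) s'"
proof -
  obtain k where k: "k \<le> K" "run orc (if bval b s then c else d) s (replicate k Tick) s'"
    using assms by (auto simp: timed_def)
  have "run orc (Cond b c d) s (replicate (Suc k) Tick) s'"
    using k(2) by (auto intro: run_CondTrue run_CondFalse split: if_splits)
  then show ?thesis using k(1) unfolding timed_def by (meson Suc_le_mono)
qed

lemma timed_While_step:
  assumes "bval b s" "timed orc c s K s'" "timed orc (While b c) s' K' s''"
  shows "timed orc (While b c) s (Suc (K + K')) s''"
proof -
  obtain k k' where k: "k \<le> K" "run orc c s (replicate k Tick) s'"
    "k' \<le> K'" "run orc (While b c) s' (replicate k' Tick) s''"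
    using assms by (auto simp: timed_def)
  have "run orc (While b c) s (replicate (Suc (k + k')) Tick) s''"
    using run_WhileTrue[OF assms(1) k(2,4)] by (simp add: replicate_add)
  then show ?thesis using k unfolding timed_def by (meson Suc_le_mono add_mono)
qed

lemma timed_While_done: "\<not> bval b s \<Longrightarrow> timed orc (While b c) s 1 s"
  unfolding timed_def by (rule exI[of _ 1]) (simp add: run_WhileFalse)

text \<open>Each of the \<open>L - p\<close> iterations pays for its body and one guard test; the
  outer \<open>Suc\<close> is the final failing test.\<close>

lemma timed_While_invariant:
  assumes step: "\<And>p s. p < L \<Longrightarrow> P p s \<Longrightarrow> bval b s \<and> (\<exists>s'. timed orc c s K s' \<and> P (Suc p) s')"
    and stop: "\<And>s. P L s \<Longrightarrow> \<not> bval b s"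
  shows "p \<le> L \<Longrightarrow> P p s \<Longrightarrow> \<exists>s'. timed orc (While b c) s (Suc (Suc K * (L - p))) s' \<and> P L s'"
proof (induction "L - p" arbitrary: p s)
  case 0
  then have "p = L" by simp
  then show ?case using stop[of s] 0 timed_While_done[of b s orc c] by auto
next
  case (Suc d)
  then have p: "p < L" by simp
  obtain s' where s': "bval b s" "timed orc c s K s'" "P (Suc p) s'"
    using step[OF p Suc.prems(2)] by blast
  obtain s'' where s'': "timed orc (While b c) s' (Suc (Suc K * (L - Suc p))) s''" "P L s''"
    using Suc.hyps(1)[OF _ Suc_leI[OF p] s'(3)] Suc.hyps(2) by (metis diff_Suc_1 diff_Suc_eq_diff_pred diff_commute)
  have "L - p = Suc (L - Suc p)" using p by simp
  then have "Suc (K + Suc (Suc K * (L - Suc p))) = Suc (Suc K * (L - p))" by simp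
  then show ?case using timed_While_step[OF s'(1,2) s''(1)] s''(2) by metis
qed

abbreviation nreg :: "nat \<Rightarrow> nexp" where "nreg i \<equiv> NLoad (NConst i)"
abbreviation rreg :: "nat \<Rightarrow> rexp" where "rreg i \<equiv> RLoad (NConst i)"

text \<open>
  \<open>sweep b a e\<close> performs \<open>a := e\<close> for all values below \<open>b\<close> of the counter in register 4, with its
  quotient and remainder modulo \<open>n\<close> maintained in registers 5 and 6, so that it serves as a loop
  over both vectors and matrices.
\<close>

definition sweep :: "nexp \<Rightarrow> nexp \<Rightarrow> rexp \<Rightarrow> com" where
  "sweep b a e = NStore (NConst 4) (NConst 0) ;; NStore (NConst 5) (NConst 0) ;;
     NStore (NConst 6) (NConst 0) ;;
     While (NLess (nreg 4) b)
       (RStore a e ;; NStore (NConst 4) (NAdd (nreg 4) (NConst 1)) ;;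
        NStore (NConst 6) (NAdd (nreg 6) (NConst 1)) ;;
        Cond (NLess (nreg 6) (nreg 0)) Skip
          (NStore (NConst 6) (NConst 0) ;; NStore (NConst 5) (NAdd (nreg 5) (NConst 1))))"

text \<open>Registers 4 to 6 are the scratch counters of \<open>sweep\<close>.\<close>

definition agree :: "(nat \<Rightarrow> nat) \<Rightarrow> (nat \<Rightarrow> nat) \<Rightarrow> bool" where
  "agree nm nm' \<longleftrightarrow> (\<forall>x. x < 4 \<or> 6 < x \<longrightarrow> nm' x = nm x)"

lemma agreeD: "agree nm nm' \<Longrightarrow> x < 4 \<or> 6 < x \<Longrightarrow> nm' x = nm x"
  by (auto simp: agree_def)

lemma agree_trans: "agree nm nm' \<Longrightarrow> agree nm' nm'' \<Longrightarrow> agree nm nm''"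
  by (simp add: agree_def)

text \<open>Cost: three resets and the last guard test make 4; each iteration takes one guard test
  and at most 6 ticks of body, the longest case being the wrap of the remainder into the
  quotient.\<close>

lemma sweep_invariant:
  assumes n: "nm 0 = n" "1 \<le> n"
    and bound: "\<And>nm' r'. agree nm nm' \<Longrightarrow> nval b (mem nm' r') = L"
    and init: "I 0 r"
    and step: "\<And>p nm' r'. p < L \<Longrightarrow> agree nm nm' \<Longrightarrow> nm' 4 = p \<Longrightarrow> nm' 5 = p div n \<Longrightarrow>
      nm' 6 = p mod n \<Longrightarrow> I p r' \<Longrightarrow> I (Suc p) (r'(nval a (mem nm' r') := rval e (mem nm' r')))"
  shows "\<exists>nm' r'. timed orc (sweep b a e) (mem nm r) (4 + 7 * L) (mem nm' r') \<and> agree nm nm' \<and> I L r'"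
proof -
  define P where "P p s \<longleftrightarrow> (\<exists>nm' r'. s = mem nm' r' \<and> agree nm nm' \<and> nm' 4 = p \<and>
    nm' 5 = p div n \<and> nm' 6 = p mod n \<and> I p r')" for p s
  let ?c = "RStore a e ;; NStore (NConst 4) (NAdd (nreg 4) (NConst 1)) ;;
        NStore (NConst 6) (NAdd (nreg 6) (NConst 1)) ;;
        Cond (NLess (nreg 6) (nreg 0)) Skip
          (NStore (NConst 6) (NConst 0) ;; NStore (NConst 5) (NAdd (nreg 5) (NConst 1)))"
  define nm0 where "nm0 = nm(4 := 0, 5 := 0, 6 := 0)"
  have "P 0 (mem nm0 r)" using init by (simp add: P_def nm0_def agree_def)
  moreover have "bval (NLess (nreg 4) b) s \<and> (\<exists>s'. timed orc ?c s 6 s' \<and> P (Suc p) s')"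
    if p: "p < L" and Ps: "P p s" for p s
  proof -
    obtain nm1 r1 where s: "s = mem nm1 r1" and ag: "agree nm nm1"
      and k: "nm1 4 = p" "nm1 5 = p div n" "nm1 6 = p mod n" and I: "I p r1"
      using Ps by (auto simp: P_def)
    have nm1: "nm1 0 = n" using agreeD[OF ag, of 0] n by simp
    define r2 where "r2 = r1(nval a (mem nm1 r1) := rval e (mem nm1 r1))"
    define nm2 where "nm2 = nm1(4 := Suc p, 6 := Suc (p mod n))"
    define nm3 where "nm3 = (if Suc (p mod n) < n then nm2 else nm2(6 := 0, 5 := Suc (p div n)))"
    have c: "timed orc (Cond (NLess (nreg 6) (nreg 0)) Skip
          (NStore (NConst 6) (NConst 0) ;; NStore (NConst 5) (NAdd (nreg 5) (NConst 1))))
        (mem nm2 r2) (Suc 2) (mem nm3 r2)"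
    proof (rule timed_Cond, cases "Suc (p mod n) < n")
      case True
      then show "timed orc (if bval (NLess (nreg 6) (nreg 0)) (mem nm2 r2) then Skip
          else NStore (NConst 6) (NConst 0) ;; NStore (NConst 5) (NAdd (nreg 5) (NConst 1)))
          (mem nm2 r2) 2 (mem nm3 r2)"
        using nm1 by (auto simp: nm3_def nm2_def intro: timed_mono[OF timed_Skip])
    next
      case False
      then have nm3_eq: "nm3 = nm2(6 := 0, 5 := Suc (p div n))" by (simp add: nm3_def)
      have "timed orc (NStore (NConst 6) (NConst 0) ;; NStore (NConst 5) (NAdd (nreg 5) (NConst 1)))
          (mem nm2 r2) 2 (mem nm3 r2)"
        unfolding nm3_eq by (rule timed_Seq[OF timed_NStore timed_NStore]) (use k in \<open>simp_all add: nm2_def\<close>)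
      then show "timed orc (if bval (NLess (nreg 6) (nreg 0)) (mem nm2 r2) then Skip
          else NStore (NConst 6) (NConst 0) ;; NStore (NConst 5) (NAdd (nreg 5) (NConst 1)))
          (mem nm2 r2) 2 (mem nm3 r2)"
        using False nm1 by (auto simp: nm2_def)
    qed
    have "timed orc ?c s 6 (mem nm3 r2)"
      unfolding s r2_def
      by (rule timed_Seq[OF timed_RStore timed_Seq[OF timed_NStore timed_Seq[OF timed_NStore
            c[unfolded nm2_def r2_def]]]]) (use k in auto)
    moreover have "P (Suc p) (mem nm3 r2)"
      unfolding P_def
    proof (intro exI conjI)
      show "agree nm nm3" using ag by (auto simp: agree_def nm3_def nm2_def)
      show "I (Suc p) r2" unfolding r2_def using step[OF p ag k I] .
      have "p mod n < n" using n(2) by simp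
      then show "nm3 5 = Suc p div n" "nm3 6 = Suc p mod n"
        using n(2) k \<open>p mod n < n\<close> by (auto simp: nm3_def nm2_def div_Suc mod_Suc)
    qed (simp_all add: nm3_def nm2_def)
    moreover have "bval (NLess (nreg 4) b) s" using p k bound[OF ag] by (simp add: s)
    ultimately show ?thesis by blast
  qed
  moreover have "\<not> bval (NLess (nreg 4) b) s" if "P L s" for s
    using that bound by (auto simp: P_def)
  ultimately obtain s' where s': "timed orc (While (NLess (nreg 4) b) ?c) (mem nm0 r)
      (Suc (Suc 6 * (L - 0))) s'" "P L s'"
    using timed_While_invariant[of L P "NLess (nreg 4) b" orc ?c 6 0 "mem nm0 r"] by auto
  have "timed orc (sweep b a e) (mem nm r) (4 + 7 * L) s'"
    unfolding sweep_def
    by (intro timed_Seq[OF timed_NStore timed_Seq[OF timed_NStore timed_Seq[OF timed_NStore s'(1)[unfolded nm0_def]]]])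
       (rule order_refl | simp)+
  then show ?thesis using s'(2) by (auto simp: P_def)
qed

text \<open>For destinations that are consecutive cells. The value may read cells outside the block
  and the old content of its own cell, which covers the in-place updates of both matrices.\<close>

lemma sweep_write:
  assumes n: "nm 0 = n" "1 \<le> n"
    and bound: "\<And>nm' r'. agree nm nm' \<Longrightarrow> nval b (mem nm' r') = L"
    and addr: "\<And>p nm' r'. p < L \<Longrightarrow> agree nm nm' \<Longrightarrow> nm' 4 = p \<Longrightarrow> nm' 5 = p div n \<Longrightarrow>
      nm' 6 = p mod n \<Longrightarrow> nval a (mem nm' r') = d + p"
    and val: "\<And>p nm' r'. p < L \<Longrightarrow> agree nm nm' \<Longrightarrow> nm' 4 = p \<Longrightarrow> nm' 5 = p div n \<Longrightarrow>
      nm' 6 = p mod n \<Longrightarrow> (\<And>x. x < d \<or> d + L \<le> x \<Longrightarrow> r' x = r x) \<Longrightarrow> r' (d + p) = r (d + p) \<Longrightarrow>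
      rval e (mem nm' r') = v p"
  obtains nm' r' where "timed orc (sweep b a e) (mem nm r) (4 + 7 * L) (mem nm' r')"
    "agree nm nm'" "\<And>p. p < L \<Longrightarrow> r' (d + p) = v p" "\<And>x. x < d \<or> d + L \<le> x \<Longrightarrow> r' x = r x"
proof -
  define I where "I q r' \<longleftrightarrow> (\<forall>p<q. r' (d + p) = v p) \<and> (\<forall>x. x < d \<or> d + q \<le> x \<longrightarrow> r' x = r x)"
    for q and r' :: "nat \<Rightarrow> real"
  have step: "I (Suc p) (r'(nval a (mem nm' r') := rval e (mem nm' r')))"
    if p: "p < L" and h: "agree nm nm'" "nm' 4 = p" "nm' 5 = p div n" "nm' 6 = p mod n" and I: "I p r'"
    for p nm' r'
  proof -
    have "rval e (mem nm' r') = v p"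
      using I p by (intro val[OF p h]) (auto simp: I_def)
    then show ?thesis using I addr[OF p h] by (auto simp: I_def less_Suc_eq)
  qed
  have "I 0 r" by (auto simp: I_def)
  then have "\<exists>nm' r'. timed orc (sweep b a e) (mem nm r) (4 + 7 * L) (mem nm' r') \<and> agree nm nm' \<and> I L r'"
    by (intro sweep_invariant[where n = n]) (use n bound step in \<open>simp_all del: fun_upd_apply\<close>)
  then show ?thesis using that by (auto simp: I_def)
qed

text \<open>Several counter values may share a destination. With one destination per row this
  computes a matrix-vector product, with a constant destination a scalar product.\<close>

lemma sweep_accumulate:
  assumes n: "nm 0 = n" "1 \<le> n"
    and bound: "\<And>nm' r'. agree nm nm' \<Longrightarrow> nval b (mem nm' r') = L"
    and addr: "\<And>p nm' r'. p < L \<Longrightarrow> agree nm nm' \<Longrightarrow> nm' 4 = p \<Longrightarrow> nm' 5 = p div n \<Longrightarrow>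
      nm' 6 = p mod n \<Longrightarrow> nval a (mem nm' r') = d p"
    and val: "\<And>p nm' r'. p < L \<Longrightarrow> agree nm nm' \<Longrightarrow> nm' 4 = p \<Longrightarrow> nm' 5 = p div n \<Longrightarrow>
      nm' 6 = p mod n \<Longrightarrow> (\<And>x. x \<notin> d ` {..<L} \<Longrightarrow> r' x = r x) \<Longrightarrow>
      rval e (mem nm' r') = r' (d p) + h p"
  obtains nm' r' where "timed orc (sweep b a e) (mem nm r) (4 + 7 * L) (mem nm' r')"
    "agree nm nm'" "\<And>x. r' x = r x + (\<Sum>p<L. if d p = x then h p else 0)"
proof -
  define I where "I q r' \<longleftrightarrow> (\<forall>x. r' x = r x + (\<Sum>p<q. if d p = x then h p else 0))"
    for q and r' :: "nat \<Rightarrow> real"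
  have step: "I (Suc p) (r'(nval a (mem nm' r') := rval e (mem nm' r')))"
    if p: "p < L" and k: "agree nm nm'" "nm' 4 = p" "nm' 5 = p div n" "nm' 6 = p mod n" and I: "I p r'"
    for p nm' r'
  proof -
    have "rval e (mem nm' r') = r' (d p) + h p"
      using I p by (intro val[OF p k]) (auto simp: I_def intro!: sum.neutral)
    then show ?thesis using I addr[OF p k] by (auto simp: I_def)
  qed
  have "I 0 r" by (auto simp: I_def)
  then have "\<exists>nm' r'. timed orc (sweep b a e) (mem nm r) (4 + 7 * L) (mem nm' r') \<and> agree nm nm' \<and> I L r'"
    by (intro sweep_invariant[where n = n]) (use n bound step in \<open>simp_all del: fun_upd_apply\<close>)
  then show ?thesis using that by (auto simp: I_def)
qed

text \<open>A segment without separation calls cannot straddle the middle event, so it lies within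
  \<open>tr\<close>, within \<open>tr'\<close>, or is empty.\<close>

lemma between_calls_SepCall:
  assumes "between_calls tr B" "between_calls tr' B"
  shows "between_calls (tr @ SepCall # tr') B"
  unfolding between_calls_def
proof (intro allI impI)
  fix us vs ws
  let ?goal = "count_list vs ProjCall \<le> 1 \<and> count_list vs GradCall \<le> 1 \<and> real (count_list vs Tick) \<le> B"
  assume eq: "tr @ SepCall # tr' = us @ vs @ ws" and vs: "SepCall \<notin> set vs"
  then obtain zs where "(tr = us @ zs \<and> zs @ SepCall # tr' = vs @ ws) \<or>
      (tr @ zs = us \<and> SepCall # tr' = zs @ vs @ ws)"
    by (auto simp: append_eq_append_conv2)
  then consider (l) zs where "tr = us @ zs" "zs @ SepCall # tr' = vs @ ws"
    | (r) zs where "SepCall # tr' = zs @ vs @ ws" by blast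
  then have "(\<exists>zs. tr = us @ vs @ zs) \<or> (\<exists>us'. tr' = us' @ vs @ ws) \<or> vs = []"
  proof cases
    case l
    then obtain ys where "(zs = vs @ ys) \<or> (zs @ ys = vs \<and> SepCall # tr' = ys @ ws)"
      by (auto simp: append_eq_append_conv2)
    then show ?thesis
    proof
      assume "zs = vs @ ys" then show ?thesis using l by auto
    next
      assume *: "zs @ ys = vs \<and> SepCall # tr' = ys @ ws"
      then have "ys = []" using vs by (cases ys) auto
      then show ?thesis using * l by auto
    qed
  next
    case r
    show ?thesis
    proof (cases zs)
      case Nil
      then show ?thesis using r vs by (cases vs) auto
    next
      case (Cons z zs')
      then show ?thesis using r by auto
    qed
  qed
  then show ?goal
  proof (elim disjE exE)
    assume "vs = []"
    \<comment> \<open>The empty segment of \<open>tr\<close> already forces a nonnegative time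
      bound.\<close>
    moreover have "0 \<le> B" using assms(1) unfolding between_calls_def
      by (metis append_Nil count_list.simps(1) empty_iff empty_set of_nat_0)
    ultimately show ?goal by simp
  next
    fix zs assume "tr = us @ vs @ zs"
    then show ?goal using assms(1) vs unfolding between_calls_def by blast
  next
    fix us' assume "tr' = us' @ vs @ ws"
    then show ?goal using assms(2) vs unfolding between_calls_def by blast
  qed
qed

lemma between_calls_segment:
  assumes "count_list tr ProjCall \<le> 1" "count_list tr GradCall \<le> 1" "count_list tr Tick \<le> K"
  shows "between_calls tr (real K)"
  using assms by (auto simp: between_calls_def)

lemma between_calls_mono:
  assumes "between_calls tr B" "B \<le> B'" shows "between_calls tr B'"
  unfolding between_calls_def
proof (intro allI impI)
  fix us vs ws assume "tr = us @ vs @ ws" "SepCall \<notin> set vs"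
  then have "count_list vs ProjCall \<le> 1 \<and> count_list vs GradCall \<le> 1 \<and> real (count_list vs Tick) \<le> B"
    using assms(1) unfolding between_calls_def by blast
  then show "count_list vs ProjCall \<le> 1 \<and> count_list vs GradCall \<le> 1 \<and> real (count_list vs Tick) \<le> B'"
    using assms(2) by linarith
qed

lemma count_list_replicate: "count_list (replicate k x) y = (if x = y then k else 0)"
  by (induction k) auto

section \<open>The program\<close>

abbreviation cell :: "nexp \<Rightarrow> nexp \<Rightarrow> rexp" where "cell b i \<equiv> RLoad (NAdd b i)"

text \<open>
  Naturals: register 7 holds \<open>n\<^sup>2\<close>, 8 the number of cuts, 9 the address of the current point, 10 the
  last oracle answer; the indices of the cuts start at 20. Reals: register 2 holds the step, 3 the
  threshold; the matrix, its inverse, the gradient, the Newton direction, the unprojected point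
  and the sequence of query points are stored consecutively from 10.
\<close>

definition addr_inv :: nexp where "addr_inv = NAdd (NConst 10) (nreg 7)"
definition addr_grad :: nexp where "addr_grad = NAdd addr_inv (nreg 7)"
definition addr_dir :: nexp where "addr_dir = NAdd addr_grad (nreg 0)"
definition addr_tgt :: nexp where "addr_tgt = NAdd addr_dir (nreg 0)"
definition addr_pts :: nexp where "addr_pts = NAdd addr_tgt (nreg 0)"

lemmas addr_defs = addr_inv_def addr_grad_def addr_dir_def addr_tgt_def addr_pts_def

text \<open>The order matters: the direction and the scalar \<open>q\<close> in cell 4 use the old
  inverse, cell 5 then receives \<open>1 + c * q\<close>, and the later sweeps read only the
  gradient, the direction, the current point, these scalars and the cell being overwritten.\<close>

definition update :: com where
  "update =
     sweep (nreg 0) (NAdd addr_dir (nreg 4)) (RConst 0) ;;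
     sweep (nreg 7) (NAdd addr_dir (nreg 5))
       (RAdd (cell addr_dir (nreg 5)) (RMul (cell addr_inv (nreg 4)) (cell addr_grad (nreg 6)))) ;;
     RStore (NConst 4) (RConst 0) ;;
     sweep (nreg 0) (NConst 4)
       (RAdd (rreg 4) (RMul (cell addr_grad (nreg 4)) (cell addr_dir (nreg 4)))) ;;
     RStore (NConst 5) (RAdd (RConst 1) (RMul (rreg 2) (rreg 4))) ;;
     RStore (NConst 3) (RAdd (rreg 3) (RDiv (rreg 4) (rreg 5))) ;;
     sweep (nreg 7) (NAdd (NConst 10) (nreg 4))
       (RAdd (cell (NConst 10) (nreg 4))
         (RMul (rreg 2) (RMul (cell addr_grad (nreg 5)) (cell addr_grad (nreg 6))))) ;;
     sweep (nreg 7) (NAdd addr_inv (nreg 4))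
       (RSub (cell addr_inv (nreg 4))
         (RMul (RDiv (rreg 2) (rreg 5)) (RMul (cell addr_dir (nreg 5)) (cell addr_dir (nreg 6))))) ;;
     sweep (nreg 0) (NAdd addr_tgt (nreg 4))
       (RSub (cell (nreg 9) (nreg 4)) (RMul (RDiv (RConst 1) (rreg 5)) (cell addr_dir (nreg 4))))"

section \<open>The effect of one Newton update on the memory\<close>

lemma matrix_index_less: "i < n \<Longrightarrow> k < n \<Longrightarrow> i * n + k < n * (n :: nat)"
  using mult_le_mono1[of "Suc i" n n] by simp

text \<open>Matrices are stored row by row, so the flat indices with quotient \<open>i\<close> are
  exactly those of row \<open>i\<close>.\<close>

lemma sum_matrix_row:
  fixes n i :: nat
  assumes "i < n"
  shows "(\<Sum>p<n * n. if p div n = i then h p else 0) = (\<Sum>k<n. h (i * n + k))"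
proof -
  have "(\<Sum>p<n * n. if p div n = i then h p else 0) = sum h {p \<in> {..<n * n}. p div n = i}"
    by (rule sum.inter_filter[symmetric]) simp
  also have "\<dots> = (\<Sum>k<n. h (i * n + k))"
    using assms by (intro sum.reindex_bij_witness[of _ "\<lambda>k. i * n + k" "\<lambda>p. p mod n"])
      (auto simp: matrix_index_less)
  finally show ?thesis .
qed

text \<open>Three sweeps of length \<open>n\<close>, three of length \<open>n * n\<close> and three
  single stores give the time bound. The bound on \<open>nm 9\<close> keeps the current point clear
  of the cells being overwritten.\<close>

lemma update_run:
  fixes nm :: "nat \<Rightarrow> nat" and r :: "nat \<Rightarrow> real"
  assumes n: "nm 0 = n" "1 \<le> n" and nm7: "nm 7 = n * n" and nm9: "10 + n * n + n * n + n + n + n \<le> nm 9"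
  defines "A \<equiv> get_mat n 10 (mem nm r)"
    and "B \<equiv> get_mat n (10 + n * n) (mem nm r)"
    and "g \<equiv> get_vec n (10 + n * n + n * n) (mem nm r)"
    and "x \<equiv> get_vec n (nm 9) (mem nm r)"
  defines "w \<equiv> B *\<^sub>v g"
  defines "q \<equiv> g \<bullet> w"
  obtains nm' r' where "timed orc update (mem nm r) (27 + 21 * (n * n) + 21 * n) (mem nm' r')"
    "agree nm nm'"
    "get_mat n 10 (mem nm' r') = A + r 2 \<cdot>\<^sub>m outer n g g"
    "get_mat n (10 + n * n) (mem nm' r') = B + (- (r 2 / (1 + r 2 * q))) \<cdot>\<^sub>m outer n w w"
    "get_vec n (10 + n * n + n * n + n + n) (mem nm' r') = x - (1 / (1 + r 2 * q)) \<cdot>\<^sub>v w"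
    "r' 3 = r 3 + q / (1 + r 2 * q)" "r' 1 = r 1" "r' 2 = r 2"
    "\<And>z. 10 + n * n + n * n + n + n + n \<le> z \<Longrightarrow> r' z = r z"
proof -
  \<comment> \<open>With \<open>N\<close> opaque, all address comparisons are linear.\<close>
  define N where "N = n * n"
  have nm7': "nm 7 = N" and nm9': "10 + N + N + n + n + n \<le> nm 9" using nm7 nm9 by (simp_all add: N_def)
  have dn: "p div n < n" "p mod n < n" if "p < N" for p
    using that n by (auto simp: N_def less_mult_imp_div_less)
  have ix: "i * n + k < N" if "i < n" "k < n" for i k
    using that by (simp add: N_def matrix_index_less)
  obtain nm1 r1 where 1: "timed orc (sweep (nreg 0) (NAdd addr_dir (nreg 4)) (RConst 0))
      (mem nm r) (4 + 7 * n) (mem nm1 r1)" "agree nm nm1"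
    and r1: "\<And>p. p < n \<Longrightarrow> r1 ((10 + N + N + n) + p) = 0"
      "\<And>z. z < 10 + N + N + n \<or> 10 + N + N + n + n \<le> z \<Longrightarrow> r1 z = r z"
    by (rule sweep_write[where nm = nm and n = n and r = r and L = n and d = "10 + N + N + n"
          and v = "\<lambda>_. 0" and b = "nreg 0" and a = "NAdd addr_dir (nreg 4)" and e = "RConst 0" and orc = orc])
       (use n nm7' in \<open>auto simp: agree_def addr_defs\<close>)
  have nm1: "nm1 0 = n" "nm1 7 = N" "nm1 9 = nm 9" using 1(2) n nm7' by (auto simp: agree_def)
  \<comment> \<open>\<open>wv\<close> and, below, \<open>qv\<close> are the entries of
    \<open>w\<close> and the number \<open>q\<close> written in terms of the initial memory; they
    are identified with \<open>w\<close> and \<open>q\<close> after the last sweep.\<close>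
  define wv where "wv i = (\<Sum>k<n. r (10 + N + (i * n + k)) * r (10 + N + N + k))" for i
  obtain nm2 r2 where 2: "timed orc (sweep (nreg 7) (NAdd addr_dir (nreg 5))
       (RAdd (cell addr_dir (nreg 5)) (RMul (cell addr_inv (nreg 4)) (cell addr_grad (nreg 6)))))
      (mem nm1 r1) (4 + 7 * N) (mem nm2 r2)" "agree nm1 nm2"
    and r2: "\<And>z. r2 z = r1 z + (\<Sum>p<N. if 10 + N + N + n + p div n = z
      then r (10 + N + p) * r (10 + N + N + p mod n) else 0)"
  proof (rule sweep_accumulate[where nm = nm1 and n = n and r = r1 and L = N and orc = orc
        and d = "\<lambda>p. 10 + N + N + n + p div n" and h = "\<lambda>p. r (10 + N + p) * r (10 + N + N + p mod n)"
        and b = "nreg 7" and a = "NAdd addr_dir (nreg 5)" and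
        e = "RAdd (cell addr_dir (nreg 5)) (RMul (cell addr_inv (nreg 4)) (cell addr_grad (nreg 6)))"])
    fix p and nm' :: "nat \<Rightarrow> nat" and r' :: "nat \<Rightarrow> real"
    assume p: "p < N" and h: "agree nm1 nm'" "nm' 4 = p" "nm' 5 = p div n" "nm' 6 = p mod n"
      and u: "\<And>z. z \<notin> (\<lambda>p. 10 + N + N + n + p div n) ` {..<N} \<Longrightarrow> r' z = r1 z"
    have "r' (10 + N + p) = r (10 + N + p)" "\<And>k. k < n \<Longrightarrow> r' (10 + N + N + k) = r (10 + N + N + k)"
      using p by (auto simp: u r1(2) image_iff)
    then show "rval (RAdd (cell addr_dir (nreg 5)) (RMul (cell addr_inv (nreg 4)) (cell addr_grad (nreg 6))))
        (mem nm' r') = r' (10 + N + N + n + p div n) + r (10 + N + p) * r (10 + N + N + p mod n)"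
      using h nm1 dn[OF p] by (simp add: agree_def addr_defs)
  qed (use n nm1 in \<open>auto simp: agree_def addr_defs\<close>)
  have r2w: "r2 (10 + N + N + n + i) = wv i" if i: "i < n" for i
    using sum_matrix_row[OF i, of "\<lambda>p. r (10 + N + p) * r (10 + N + N + p mod n)"] r1(1)[OF i]
    by (simp add: r2 wv_def N_def[symmetric])
  have r2o: "r2 z = r z" if "z < 10 + N + N + n \<or> 10 + N + N + n + n \<le> z" for z
  proof -
    have "10 + N + N + n + p div n \<noteq> z" if "p < N" for p
      using \<open>z < _ \<or> _\<close> dn[OF that] by linarith
    then show ?thesis by (simp add: r2 r1(2)[OF that])
  qed
  have nm2: "nm2 0 = n" "nm2 7 = N" "nm2 9 = nm 9" using 2(2) nm1 by (auto simp: agree_def)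
  define r3 where "r3 = r2(4 := 0)"
  have 3: "timed orc (RStore (NConst 4) (RConst 0)) (mem nm2 r2) 1 (mem nm2 r3)"
    unfolding r3_def by (rule timed_RStore) simp_all
  define qv where "qv = (\<Sum>k<n. r (10 + N + N + k) * wv k)"
  obtain nm4 r4 where 4: "timed orc (sweep (nreg 0) (NConst 4)
       (RAdd (rreg 4) (RMul (cell addr_grad (nreg 4)) (cell addr_dir (nreg 4)))))
      (mem nm2 r3) (4 + 7 * n) (mem nm4 r4)" "agree nm2 nm4"
    and r4: "\<And>z. r4 z = r3 z + (\<Sum>p<n. if 4 = z then r (10 + N + N + p) * wv p else 0)"
  proof (rule sweep_accumulate[where nm = nm2 and n = n and r = r3 and L = n and orc = orc
        and d = "\<lambda>p. 4" and h = "\<lambda>p. r (10 + N + N + p) * wv p"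
        and b = "nreg 0" and a = "NConst 4" and
        e = "RAdd (rreg 4) (RMul (cell addr_grad (nreg 4)) (cell addr_dir (nreg 4)))"])
    fix p and nm' :: "nat \<Rightarrow> nat" and r' :: "nat \<Rightarrow> real"
    assume p: "p < n" and h: "agree nm2 nm'" "nm' 4 = p" "nm' 5 = p div n" "nm' 6 = p mod n"
      and u: "\<And>z. z \<notin> (\<lambda>p. 4) ` {..<n} \<Longrightarrow> r' z = r3 z"
    have "r' (10 + N + N + p) = r (10 + N + N + p)" "r' (10 + N + N + n + p) = wv p"
      using p r2w[OF p] by (auto simp: u r3_def r2o image_iff)
    then show "rval (RAdd (rreg 4) (RMul (cell addr_grad (nreg 4)) (cell addr_dir (nreg 4)))) (mem nm' r') =
        r' 4 + r (10 + N + N + p) * wv p"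
      using h nm2 by (simp add: agree_def addr_defs)
  qed (use n nm2 in \<open>auto simp: agree_def addr_defs\<close>)
  have nm4: "nm4 0 = n" "nm4 7 = N" "nm4 9 = nm 9" using 4(2) nm2 by (auto simp: agree_def)
  have r4q: "r4 4 = qv" by (simp add: r4 r3_def qv_def)
  have r4o: "r4 z = r2 z" if "z \<noteq> 4" for z using that by (simp add: r4 r3_def)
  define \<kappa> where "\<kappa> = 1 + r 2 * qv"
  define r5 where "r5 = r4(5 := \<kappa>)"
  have 5: "timed orc (RStore (NConst 5) (RAdd (RConst 1) (RMul (rreg 2) (rreg 4)))) (mem nm4 r4) 1 (mem nm4 r5)"
    unfolding r5_def by (rule timed_RStore) (simp_all add: r4q r4o r2o \<kappa>_def)
  define r6 where "r6 = r5(3 := r 3 + qv / \<kappa>)"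
  have 6: "timed orc (RStore (NConst 3) (RAdd (rreg 3) (RDiv (rreg 4) (rreg 5)))) (mem nm4 r5) 1 (mem nm4 r6)"
    unfolding r6_def by (rule timed_RStore) (simp_all add: r5_def r4q r4o r2o)
  have r6: "r6 5 = \<kappa>" "r6 3 = r 3 + qv / \<kappa>" "r6 1 = r 1" "r6 2 = r 2"
    "\<And>i. i < n \<Longrightarrow> r6 (10 + N + N + n + i) = wv i"
    "\<And>z. 10 \<le> z \<Longrightarrow> z < 10 + N + N + n \<or> 10 + N + N + n + n \<le> z \<Longrightarrow> r6 z = r z"
    using r2w by (simp_all add: r6_def r5_def r4o r2o)
  obtain nm7 r7 where 7: "timed orc (sweep (nreg 7) (NAdd (NConst 10) (nreg 4))
       (RAdd (cell (NConst 10) (nreg 4))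
         (RMul (rreg 2) (RMul (cell addr_grad (nreg 5)) (cell addr_grad (nreg 6))))))
      (mem nm4 r6) (4 + 7 * N) (mem nm7 r7)" "agree nm4 nm7"
    and r7: "\<And>p. p < N \<Longrightarrow> r7 (10 + p) = r (10 + p) +
        r 2 * (r (10 + N + N + p div n) * r (10 + N + N + p mod n))"
      "\<And>z. z < 10 \<or> 10 + N \<le> z \<Longrightarrow> r7 z = r6 z"
  proof (rule sweep_write[where nm = nm4 and n = n and r = r6 and L = N and d = 10 and orc = orc
        and v = "\<lambda>p. r (10 + p) + r 2 * (r (10 + N + N + p div n) * r (10 + N + N + p mod n))"
        and b = "nreg 7" and a = "NAdd (NConst 10) (nreg 4)" and e = "RAdd (cell (NConst 10) (nreg 4))
         (RMul (rreg 2) (RMul (cell addr_grad (nreg 5)) (cell addr_grad (nreg 6))))"])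
    fix p and nm' :: "nat \<Rightarrow> nat" and r' :: "nat \<Rightarrow> real"
    assume p: "p < N" and h: "agree nm4 nm'" "nm' 4 = p" "nm' 5 = p div n" "nm' 6 = p mod n"
      and u: "\<And>z. z < 10 \<or> 10 + N \<le> z \<Longrightarrow> r' z = r6 z" "r' (10 + p) = r6 (10 + p)"
    show "rval (RAdd (cell (NConst 10) (nreg 4))
         (RMul (rreg 2) (RMul (cell addr_grad (nreg 5)) (cell addr_grad (nreg 6))))) (mem nm' r') =
        r (10 + p) + r 2 * (r (10 + N + N + p div n) * r (10 + N + N + p mod n))"
      using h nm4 p dn[OF p] by (simp add: agree_def addr_defs u r6)
  qed (use n nm4 in \<open>auto simp: agree_def addr_defs\<close>)
  have nm7: "nm7 0 = n" "nm7 7 = N" "nm7 9 = nm 9" using 7(2) nm4 by (auto simp: agree_def)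
  obtain nm8 r8 where 8: "timed orc (sweep (nreg 7) (NAdd addr_inv (nreg 4))
       (RSub (cell addr_inv (nreg 4))
         (RMul (RDiv (rreg 2) (rreg 5)) (RMul (cell addr_dir (nreg 5)) (cell addr_dir (nreg 6))))))
      (mem nm7 r7) (4 + 7 * N) (mem nm8 r8)" "agree nm7 nm8"
    and r8: "\<And>p. p < N \<Longrightarrow> r8 ((10 + N) + p) = r (10 + N + p) - r 2 / \<kappa> * (wv (p div n) * wv (p mod n))"
      "\<And>z. z < 10 + N \<or> 10 + N + N \<le> z \<Longrightarrow> r8 z = r7 z"
  proof (rule sweep_write[where nm = nm7 and n = n and r = r7 and L = N and d = "10 + N" and orc = orc
        and v = "\<lambda>p. r (10 + N + p) - r 2 / \<kappa> * (wv (p div n) * wv (p mod n))"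
        and b = "nreg 7" and a = "NAdd addr_inv (nreg 4)" and e = "RSub (cell addr_inv (nreg 4))
         (RMul (RDiv (rreg 2) (rreg 5)) (RMul (cell addr_dir (nreg 5)) (cell addr_dir (nreg 6))))"])
    fix p and nm' :: "nat \<Rightarrow> nat" and r' :: "nat \<Rightarrow> real"
    assume p: "p < N" and h: "agree nm7 nm'" "nm' 4 = p" "nm' 5 = p div n" "nm' 6 = p mod n"
      and u: "\<And>z. z < 10 + N \<or> 10 + N + N \<le> z \<Longrightarrow> r' z = r7 z" "r' (10 + N + p) = r7 (10 + N + p)"
    show "rval (RSub (cell addr_inv (nreg 4))
         (RMul (RDiv (rreg 2) (rreg 5)) (RMul (cell addr_dir (nreg 5)) (cell addr_dir (nreg 6))))) (mem nm' r') =
        r (10 + N + p) - r 2 / \<kappa> * (wv (p div n) * wv (p mod n))"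
      using h nm7 p dn[OF p] r6(5)[OF dn(1)[OF p]] r6(5)[OF dn(2)[OF p]] by (simp add: agree_def addr_defs u r7(2) r6)
  qed (use n nm7 in \<open>auto simp: agree_def addr_defs\<close>)
  have nm8: "nm8 0 = n" "nm8 7 = N" "nm8 9 = nm 9" using 8(2) nm7 by (auto simp: agree_def)
  obtain nm9 r9 where 9: "timed orc (sweep (nreg 0) (NAdd addr_tgt (nreg 4))
       (RSub (cell (nreg 9) (nreg 4)) (RMul (RDiv (RConst 1) (rreg 5)) (cell addr_dir (nreg 4)))))
      (mem nm8 r8) (4 + 7 * n) (mem nm9 r9)" "agree nm8 nm9"
    and r9: "\<And>p. p < n \<Longrightarrow> r9 ((10 + N + N + n + n) + p) = r (nm 9 + p) - 1 / \<kappa> * wv p"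
      "\<And>z. z < 10 + N + N + n + n \<or> 10 + N + N + n + n + n \<le> z \<Longrightarrow> r9 z = r8 z"
  proof (rule sweep_write[where nm = nm8 and n = n and r = r8 and L = n and d = "10 + N + N + n + n" and orc = orc
        and v = "\<lambda>p. r (nm 9 + p) - 1 / \<kappa> * wv p"
        and b = "nreg 0" and a = "NAdd addr_tgt (nreg 4)" and
        e = "RSub (cell (nreg 9) (nreg 4)) (RMul (RDiv (RConst 1) (rreg 5)) (cell addr_dir (nreg 4)))"])
    fix p and nm' :: "nat \<Rightarrow> nat" and r' :: "nat \<Rightarrow> real"
    assume p: "p < n" and h: "agree nm8 nm'" "nm' 4 = p" "nm' 5 = p div n" "nm' 6 = p mod n"
      and u: "\<And>z. z < 10 + N + N + n + n \<or> 10 + N + N + n + n + n \<le> z \<Longrightarrow> r' z = r8 z"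
        "r' (10 + N + N + n + n + p) = r8 (10 + N + N + n + n + p)"
    show "rval (RSub (cell (nreg 9) (nreg 4)) (RMul (RDiv (RConst 1) (rreg 5)) (cell addr_dir (nreg 4)))) (mem nm' r') =
        r (nm 9 + p) - 1 / \<kappa> * wv p"
      using h nm8 p nm9' r6(5)[OF p] by (simp add: agree_def addr_defs u r8(2) r7(2) r6)
  qed (use n nm8 in \<open>auto simp: agree_def addr_defs\<close>)
  have timed: "timed orc update (mem nm r) (27 + 21 * (n * n) + 21 * n) (mem nm9 r9)"
    unfolding update_def
    by (rule timed_Seq[OF 1(1) timed_Seq[OF 2(1) timed_Seq[OF 3 timed_Seq[OF 4(1) timed_Seq[OF 5
          timed_Seq[OF 6 timed_Seq[OF 7(1) timed_Seq[OF 8(1) 9(1)]]]]]]]]) (rule order_refl | simp add: N_def)+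
  have ag: "agree nm nm9" using 1(2) 2(2) 4(2) 7(2) 8(2) 9(2) by (blast intro: agree_trans)
  have wi: "w $ i = wv i" if "i < n" for i
    using that by (simp add: w_def B_def g_def get_mat_def get_vec_def scalar_prod_def wv_def N_def
        lessThan_atLeast0 add.assoc)
  have wd: "dim_vec w = n" by (simp add: w_def B_def get_mat_def)
  have q: "q = qv"
    by (simp add: q_def qv_def scalar_prod_def wd wi lessThan_atLeast0)
       (simp add: g_def get_vec_def N_def)
  have k: "1 + r 2 * q = \<kappa>" by (simp add: q \<kappa>_def)
  show thesis
  proof (rule that[OF timed ag])
    show "get_mat n 10 (mem nm9 r9) = A + r 2 \<cdot>\<^sub>m outer n g g"
    proof (rule eq_matI)
      fix i j assume "i < dim_row (A + r 2 \<cdot>\<^sub>m outer n g g)" "j < dim_col (A + r 2 \<cdot>\<^sub>m outer n g g)"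
      then have ij: "i < n" "j < n" by (simp_all add: outer_def)
      have "r9 (10 + (i * n + j)) = r7 (10 + (i * n + j))"
        using ix[OF ij] by (simp add: r9(2) r8(2))
      also have "\<dots> = r (10 + (i * n + j)) + r 2 * (r (10 + N + N + i) * r (10 + N + N + j))"
        using ix[OF ij] ij by (simp add: r7(1))
      finally show "get_mat n 10 (mem nm9 r9) $$ (i, j) = (A + r 2 \<cdot>\<^sub>m outer n g g) $$ (i, j)"
        using ij by (simp add: get_mat_def A_def outer_def g_def get_vec_def N_def add.assoc)
    qed (simp_all add: get_mat_def A_def outer_def)
    show "get_mat n (10 + n * n) (mem nm9 r9) = B + (- (r 2 / (1 + r 2 * q))) \<cdot>\<^sub>m outer n w w" (is "_ = ?R")
    proof (rule eq_matI)
      fix i j assume "i < dim_row ?R" "j < dim_col ?R"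
      then have ij: "i < n" "j < n" by (simp_all add: outer_def)
      have "r9 (10 + N + (i * n + j)) = r8 (10 + N + (i * n + j))"
        using ix[OF ij] by (simp add: r9(2))
      also have "\<dots> = r (10 + N + (i * n + j)) - r 2 / \<kappa> * (wv i * wv j)"
        using ix[OF ij] ij by (simp add: r8(1))
      finally show "get_mat n (10 + n * n) (mem nm9 r9) $$ (i, j) = ?R $$ (i, j)"
        using ij by (simp add: get_mat_def B_def outer_def wi k N_def add.assoc)
    qed (simp_all add: get_mat_def B_def outer_def)
    show "get_vec n (10 + n * n + n * n + n + n) (mem nm9 r9) = x - (1 / (1 + r 2 * q)) \<cdot>\<^sub>v w"
      unfolding k by (rule eq_vecI) (use r9(1) in \<open>auto simp: get_vec_def x_def wd wi N_def\<close>)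
    show "r9 3 = r 3 + q / (1 + r 2 * q)" unfolding k
      by (simp add: r9(2) r8(2) r7(2) r6 q)
    show "r9 1 = r 1" "r9 2 = r 2" using r6(3,4) by (simp_all add: r9(2) r8(2) r7(2))
    show "r9 z = r z" if "10 + n * n + n * n + n + n + n \<le> z" for z
      using that[folded N_def] by (simp add: r9(2) r8(2) r7(2) r6)
  qed
qed

text \<open>Naturals cannot be multiplied, so the square of \<open>n\<close> is formed by repeated
  addition. Entries of the identity matrix and of the unit vector are obtained from truncated
  subtraction.\<close>

definition init :: com where
  "init =
     While (NLess (nreg 5) (nreg 0))
       (NStore (NConst 7) (NAdd (nreg 7) (nreg 0)) ;;
        NStore (NConst 5) (NAdd (nreg 5) (NConst 1))) ;;
     RStore (NConst 2) (RDiv (RConst 1) (RMul (RConst 2) (rreg 0))) ;;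
     RStore (NConst 5) (RAdd (RMul (ROfNat (nreg 0)) (rreg 0)) (rreg 1)) ;;
     RStore (NConst 3) (RMul (RConst 2) (rreg 5)) ;;
     sweep (nreg 7) (NAdd (NConst 10) (nreg 4)) (RMul (rreg 5)
       (ROfNat (NSub (NSub (NConst 1) (NSub (nreg 5) (nreg 6))) (NSub (nreg 6) (nreg 5))))) ;;
     sweep (nreg 7) (NAdd addr_inv (nreg 4)) (RMul (RDiv (RConst 1) (rreg 5))
       (ROfNat (NSub (NSub (NConst 1) (NSub (nreg 5) (nreg 6))) (NSub (nreg 6) (nreg 5))))) ;;
     sweep (nreg 0) (NAdd addr_pts (nreg 4)) (ROfNat (NSub (NConst 1) (nreg 4))) ;;
     NStore (NConst 9) addr_pts"

text \<open>The squaring loop costs \<open>3 * n + 1\<close>, the two matrix sweeps and the vector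
  sweep \<open>12 + 14 * (n * n) + 7 * n\<close>, and the four single stores 4.\<close>

lemma init_run:
  assumes n: "1 \<le> n"
  obtains nm r where "timed orc init (initial n m G \<epsilon>) (17 + 14 * (n * n) + 10 * n) (mem nm r)"
    "nm 0 = n" "nm 7 = n * n" "nm 8 = 0" "nm 9 = 10 + n * n + n * n + n + n + n"
    "r 1 = \<epsilon>" "r 2 = 1 / (2 * G)" "r 3 = 2 * (real n * G + \<epsilon>)"
    "get_mat n 10 (mem nm r) = (real n * G + \<epsilon>) \<cdot>\<^sub>m 1\<^sub>m n"
    "get_mat n (10 + n * n) (mem nm r) = (1 / (real n * G + \<epsilon>)) \<cdot>\<^sub>m 1\<^sub>m n"
    "get_vec n (10 + n * n + n * n + n + n + n) (mem nm r) = unit_vec n 0"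
proof -
  define nmi where "nmi = nmem (initial n m G \<epsilon>)"
  define ri where "ri = rmem (initial n m G \<epsilon>)"
  have init: "initial n m G \<epsilon> = mem nmi ri" by (simp add: nmi_def ri_def initial_def)
  have nmi: "nmi 0 = n" "nmi 5 = 0" "nmi 7 = 0" "nmi 8 = 0" by (simp_all add: nmi_def initial_def)
  have ri: "ri 0 = G" "ri 1 = \<epsilon>" "ri (Suc 0) = \<epsilon>" by (simp_all add: ri_def initial_def)
  define N where "N = n * n"
  let ?sq = "NStore (NConst 7) (NAdd (nreg 7) (nreg 0)) ;; NStore (NConst 5) (NAdd (nreg 5) (NConst 1))"
  \<comment> \<open>After \<open>p\<close> rounds register 7 holds \<open>p * n\<close>; the loop
    relies on registers 5 and 7 being 0 in the initial memory.\<close>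
  define P where "P p s \<longleftrightarrow> s = mem (nmi(5 := p, 7 := p * n)) ri" for p s
  have "P 0 (mem nmi ri)" using nmi by (auto simp: P_def fun_eq_iff)
  moreover have "bval (NLess (nreg 5) (nreg 0)) s \<and> (\<exists>s'. timed orc ?sq s 2 s' \<and> P (Suc p) s')"
    if "p < n" "P p s" for p s
  proof -
    have "timed orc ?sq (mem (nmi(5 := p, 7 := p * n)) ri) 2
        (mem ((nmi(5 := p, 7 := p * n))(7 := p * n + n, 5 := Suc p)) ri)"
      by (rule timed_Seq[OF timed_NStore timed_NStore]) (use nmi in auto)
    moreover have "(nmi(5 := p, 7 := p * n))(7 := p * n + n, 5 := Suc p) = nmi(5 := Suc p, 7 := Suc p * n)"
      by (auto simp: fun_eq_iff)
    ultimately show ?thesis using that nmi by (auto simp: P_def)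
  qed
  moreover have "\<not> bval (NLess (nreg 5) (nreg 0)) s" if "P n s" for s
    using that nmi by (simp add: P_def)
  ultimately obtain s' where "timed orc (While (NLess (nreg 5) (nreg 0)) ?sq) (mem nmi ri)
      (Suc (Suc 2 * (n - 0))) s'" "P n s'"
    using timed_While_invariant[of n P "NLess (nreg 5) (nreg 0)" orc ?sq 2 0 "mem nmi ri"] by auto
  moreover define nm0 where "nm0 = nmi(5 := n, 7 := N)"
  ultimately have 0: "timed orc (While (NLess (nreg 5) (nreg 0)) ?sq) (mem nmi ri) (3 * n + 1) (mem nm0 ri)"
    by (simp add: P_def N_def)
  have nm0: "nm0 0 = n" "nm0 7 = N" "nm0 8 = 0" using nmi by (simp_all add: nm0_def)
  define a where "a = real n * G + \<epsilon>"
  define r1 where "r1 = ri(2 := 1 / (2 * G))"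
  define r2 where "r2 = r1(5 := a)"
  define r3 where "r3 = r2(3 := 2 * a)"
  have 1: "timed orc (RStore (NConst 2) (RDiv (RConst 1) (RMul (RConst 2) (rreg 0)))) (mem nm0 ri) 1 (mem nm0 r1)"
    unfolding r1_def by (rule timed_RStore) (simp_all add: ri)
  have 2: "timed orc (RStore (NConst 5) (RAdd (RMul (ROfNat (nreg 0)) (rreg 0)) (rreg 1))) (mem nm0 r1) 1 (mem nm0 r2)"
    unfolding r2_def by (rule timed_RStore) (simp_all add: ri r1_def nm0 a_def)
  have 3: "timed orc (RStore (NConst 3) (RMul (RConst 2) (rreg 5))) (mem nm0 r2) 1 (mem nm0 r3)"
    unfolding r3_def by (rule timed_RStore) (simp_all add: r2_def)
  have r3: "r3 5 = a" "r3 1 = \<epsilon>" "r3 2 = 1 / (2 * G)" "r3 3 = 2 * a" by (simp_all add: r3_def r2_def r1_def ri)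
  let ?\<delta> = "ROfNat (NSub (NSub (NConst 1) (NSub (nreg 5) (nreg 6))) (NSub (nreg 6) (nreg 5)))"
  \<comment> \<open>At most one of the two truncated differences is nonzero, and both vanish exactly
    on the diagonal.\<close>
  have delta: "1 - (i - k) - (k - i) = (if i = k then 1 else 0)" for i k :: nat by auto
  obtain nm4 r4 where 4: "timed orc (sweep (nreg 7) (NAdd (NConst 10) (nreg 4)) (RMul (rreg 5) ?\<delta>))
      (mem nm0 r3) (4 + 7 * N) (mem nm4 r4)" "agree nm0 nm4"
    and r4: "\<And>p. p < N \<Longrightarrow> r4 (10 + p) = a * (if p div n = p mod n then 1 else 0)"
      "\<And>z. z < 10 \<or> 10 + N \<le> z \<Longrightarrow> r4 z = r3 z"
    by (rule sweep_write[where nm = nm0 and n = n and r = r3 and L = N and d = 10 and orc = orc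
          and v = "\<lambda>p. a * (if p div n = p mod n then 1 else 0)" and b = "nreg 7"
          and a = "NAdd (NConst 10) (nreg 4)" and e = "RMul (rreg 5) ?\<delta>"])
       (use n nm0 r3 in \<open>auto simp: agree_def delta\<close>)
  have nm4: "nm4 0 = n" "nm4 7 = N" "nm4 8 = 0" using 4(2) nm0 by (auto simp: agree_def)
  obtain nm5 r5 where 5: "timed orc (sweep (nreg 7) (NAdd addr_inv (nreg 4)) (RMul (RDiv (RConst 1) (rreg 5)) ?\<delta>))
      (mem nm4 r4) (4 + 7 * N) (mem nm5 r5)" "agree nm4 nm5"
    and r5: "\<And>p. p < N \<Longrightarrow> r5 ((10 + N) + p) = 1 / a * (if p div n = p mod n then 1 else 0)"
      "\<And>z. z < 10 + N \<or> 10 + N + N \<le> z \<Longrightarrow> r5 z = r4 z"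
    by (rule sweep_write[where nm = nm4 and n = n and r = r4 and L = N and d = "10 + N" and orc = orc
          and v = "\<lambda>p. 1 / a * (if p div n = p mod n then 1 else 0)" and b = "nreg 7"
          and a = "NAdd addr_inv (nreg 4)" and e = "RMul (RDiv (RConst 1) (rreg 5)) ?\<delta>"])
       (use n nm4 r3 in \<open>auto simp: agree_def delta addr_defs r4(2)\<close>)
  have nm5: "nm5 0 = n" "nm5 7 = N" "nm5 8 = 0" using 5(2) nm4 by (auto simp: agree_def)
  obtain nm6 r6 where 6: "timed orc (sweep (nreg 0) (NAdd addr_pts (nreg 4)) (ROfNat (NSub (NConst 1) (nreg 4))))
      (mem nm5 r5) (4 + 7 * n) (mem nm6 r6)" "agree nm5 nm6"
    and r6: "\<And>p. p < n \<Longrightarrow> r6 ((10 + N + N + n + n + n) + p) = (if p = 0 then 1 else 0)"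
      "\<And>z. z < 10 + N + N + n + n + n \<or> 10 + N + N + n + n + n + n \<le> z \<Longrightarrow> r6 z = r5 z"
    by (rule sweep_write[where nm = nm5 and n = n and r = r5 and L = n and d = "10 + N + N + n + n + n"
          and orc = orc and v = "\<lambda>p. (if p = 0 then 1 else 0)" and b = "nreg 0"
          and a = "NAdd addr_pts (nreg 4)" and e = "ROfNat (NSub (NConst 1) (nreg 4))"])
       (use n nm5 in \<open>auto simp: agree_def addr_defs\<close>)
  have nm6: "nm6 0 = n" "nm6 7 = N" "nm6 8 = 0" using 6(2) nm5 by (auto simp: agree_def)
  define nm7 where "nm7 = nm6(9 := 10 + N + N + n + n + n)"
  have 7: "timed orc (NStore (NConst 9) addr_pts) (mem nm6 r6) 1 (mem nm7 r6)"
    unfolding nm7_def by (rule timed_NStore) (simp_all add: addr_defs nm6)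
  have timed: "timed orc init (initial n m G \<epsilon>) (17 + 14 * (n * n) + 10 * n) (mem nm7 r6)"
    unfolding init_def init
    by (rule timed_Seq[OF 0 timed_Seq[OF 1 timed_Seq[OF 2 timed_Seq[OF 3 timed_Seq[OF 4(1)
          timed_Seq[OF 5(1) timed_Seq[OF 6(1) 7]]]]]]]) (rule order_refl | simp add: N_def)+
  have ix: "i * n + k < N" if "i < n" "k < n" for i k using that by (simp add: N_def matrix_index_less)
  show thesis
  proof (rule that[OF timed])
    show "nm7 0 = n" "nm7 7 = n * n" "nm7 8 = 0" "nm7 9 = 10 + n * n + n * n + n + n + n"
      by (simp_all add: nm7_def nm6 N_def)
    show "r6 1 = \<epsilon>" "r6 2 = 1 / (2 * G)" "r6 3 = 2 * (real n * G + \<epsilon>)"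
      using r3 by (simp_all add: r6(2) r5(2) r4(2) a_def)
    show "get_mat n 10 (mem nm7 r6) = (real n * G + \<epsilon>) \<cdot>\<^sub>m 1\<^sub>m n"
    proof (rule eq_matI)
      fix i k assume "i < dim_row ((real n * G + \<epsilon>) \<cdot>\<^sub>m 1\<^sub>m n)" "k < dim_col ((real n * G + \<epsilon>) \<cdot>\<^sub>m 1\<^sub>m n)"
      then have ik: "i < n" "k < n" by simp_all
      have "r6 (10 + (i * n + k)) = r4 (10 + (i * n + k))" using ix[OF ik] by (simp add: r6(2) r5(2))
      also have "\<dots> = a * (if i = k then 1 else 0)" using ix[OF ik] ik by (simp add: r4(1))
      finally show "get_mat n 10 (mem nm7 r6) $$ (i, k) = ((real n * G + \<epsilon>) \<cdot>\<^sub>m 1\<^sub>m n) $$ (i, k)"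
        using ik by (simp add: get_mat_def a_def add.assoc)
    qed (simp_all add: get_mat_def)
    show "get_mat n (10 + n * n) (mem nm7 r6) = (1 / (real n * G + \<epsilon>)) \<cdot>\<^sub>m 1\<^sub>m n"
    proof (rule eq_matI)
      fix i k assume "i < dim_row ((1 / (real n * G + \<epsilon>)) \<cdot>\<^sub>m 1\<^sub>m n)"
        "k < dim_col ((1 / (real n * G + \<epsilon>)) \<cdot>\<^sub>m 1\<^sub>m n)"
      then have ik: "i < n" "k < n" by simp_all
      have "r6 (10 + N + (i * n + k)) = r5 (10 + N + (i * n + k))" using ix[OF ik] by (simp add: r6(2))
      also have "\<dots> = 1 / a * (if i = k then 1 else 0)" using ix[OF ik] ik by (simp add: r5(1))
      finally show "get_mat n (10 + n * n) (mem nm7 r6) $$ (i, k) = ((1 / (real n * G + \<epsilon>)) \<cdot>\<^sub>m 1\<^sub>m n) $$ (i, k)"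
        using ik by (simp add: get_mat_def a_def N_def add.assoc)
    qed (simp_all add: get_mat_def)
    show "get_vec n (10 + n * n + n * n + n + n + n) (mem nm7 r6) = unit_vec n 0"
      by (rule eq_vecI) (use r6(1) in \<open>auto simp: get_vec_def unit_vec_def N_def\<close>)
  qed
qed

text \<open>The loop ends on FAIL, encoded as 0, or as soon as the cuts certify
  infeasibility.\<close>

definition loop_guard :: bexp where
  "loop_guard = BAnd (NLess (NConst 0) (nreg 10)) (RLess (RMul (ROfNat (nreg 8)) (rreg 1)) (rreg 3))"

text \<open>The separation call comes last, so one iteration up to it is one stretch between calls.
  Each new point is stored directly behind the previous ones, which keeps all points available for
  the certificate.\<close>

definition body :: com where
  "body =
     NStore (NAdd (NConst 20) (nreg 8)) (NSub (nreg 10) (NConst 1)) ;;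
     Gradient (NSub (nreg 10) (NConst 1)) (nreg 9) addr_grad ;;
     update ;;
     Project (NConst 10) addr_tgt (NAdd (nreg 9) (nreg 0)) ;;
     NStore (NConst 9) (NAdd (nreg 9) (nreg 0)) ;;
     NStore (NConst 8) (NAdd (nreg 8) (NConst 1)) ;;
     Separate (nreg 9) (NConst 10)"

text \<open>Register 0 holds \<open>n\<close>, on which \<open>addr_pts\<close> depends, until the
  last instruction turns it into the result flag.\<close>

definition finish :: com where
  "finish = Cond (NLess (NConst 0) (nreg 10))
     (NStore (NConst 3) addr_pts ;; NStore (NConst 2) (NConst 20) ;;
      NStore (NConst 1) (nreg 8) ;; NStore (NConst 0) (NConst 1))
     (NStore (NConst 1) (nreg 9) ;; NStore (NConst 0) (NConst 0))"

definition newton_program :: com where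
  "newton_program = init ;; Separate (nreg 9) (NConst 10) ;; While loop_guard body ;; finish"

section \<open>Reading vectors and matrices from memory\<close>

lemma get_mat_cong:
  assumes "\<And>p. p < n * n \<Longrightarrow> r' (b + p) = r (b + p)"
  shows "get_mat n b (mem nm' r') = get_mat n b (mem nm r)"
  unfolding get_mat_def
proof (rule cong_mat)
  fix i k assume ik: "i < n" "k < n"
  show "(case (i, k) of (i, k) \<Rightarrow> rmem (mem nm' r') (b + i * n + k)) =
      (case (i, k) of (i, k) \<Rightarrow> rmem (mem nm r) (b + i * n + k))"
    using assms[OF matrix_index_less[OF ik]] by (simp add: add.assoc)
qed simp_all

lemma get_vec_cong:
  "(\<And>i. i < n \<Longrightarrow> r' (b + i) = r (b + i)) \<Longrightarrow> get_vec n b (mem nm' r') = get_vec n b (mem nm r)"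
  unfolding get_vec_def by (rule eq_vecI) auto

lemma get_vec_set_vec:
  "v \<in> carrier_vec n \<Longrightarrow> get_vec n b (set_vec n b v s) = v"
  unfolding get_vec_def set_vec_def by (rule eq_vecI) auto

section \<open>Correctness and cost of runs of the whole program\<close>

context feasibility_instance
begin

abbreviation orc :: oracles where
  "orc \<equiv> \<lparr>dim = n, num = m, separate = sep, gradient = df, project = proj\<rparr>"

definition pts :: nat where "pts = 10 + n * n + n * n + n + n + n"

text \<open>The invariant at the loop head: the history is read off the memory itself, and register
  10 already contains the oracle's answer for the current point.\<close>

definition state_inv :: "nat \<Rightarrow> (nat \<Rightarrow> nat) \<Rightarrow> (nat \<Rightarrow> real) \<Rightarrow> bool" where
  "state_inv T nm r \<longleftrightarrow> nm 0 = n \<and> nm 7 = n * n \<and> nm 8 = T \<and> nm 9 = pts + T * n \<and>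
     r 1 = \<epsilon> \<and> r 2 = step \<and>
     ons_inv T (get_mat n 10 (mem nm r)) (get_mat n (10 + n * n) (mem nm r)) (r 3)
       (\<lambda>t. nm (20 + t)) (\<lambda>t. get_vec n (pts + t * n) (mem nm r)) \<and>
     nm 10 = (case sep (get_vec n (nm 9) (mem nm r)) of None \<Rightarrow> 0 | Some j \<Rightarrow> j + 1)"

text \<open>The shape of the trace is exposed because one gradient and one projection have to be
  counted before the separation call. The ticks are those of \<open>update\<close> and of three
  stores.\<close>

lemma body_run:
  assumes I: "state_inv T nm r" and pos: "0 < nm 10"
  shows "\<exists>k1 k2 k3 nm' r'. run orc body (mem nm r)
      (replicate k1 Tick @ [GradCall] @ replicate k2 Tick @ [ProjCall] @ replicate k3 Tick @ [SepCall])
      (mem nm' r') \<and> k1 + k2 + k3 \<le> 30 + 21 * (n * n) + 21 * n \<and> state_inv (Suc T) nm' r'"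
proof -
  define A where "A = get_mat n 10 (mem nm r)"
  define B where "B = get_mat n (10 + n * n) (mem nm r)"
  define xs where "xs t = get_vec n (pts + t * n) (mem nm r)" for t
  have nm: "nm 0 = n" "nm 7 = n * n" "nm 8 = T" "nm 9 = pts + T * n" and r: "r 1 = \<epsilon>" "r 2 = step"
    and ons: "ons_inv T A B (r 3) (\<lambda>t. nm (20 + t)) xs"
    and nm10: "nm 10 = (case sep (xs T) of None \<Rightarrow> 0 | Some j \<Rightarrow> j + 1)"
    using I unfolding state_inv_def A_def B_def xs_def by auto
  have x: "xs T \<in> simplex n" using ons by (simp add: ons_inv_def)
  \<comment> \<open>A positive answer encodes the index \<open>j\<close> as
    \<open>j + 1\<close>.\<close>
  obtain j where j: "sep (xs T) = Some j" "nm 10 = Suc j"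
    using pos nm10 by (cases "sep (xs T)") auto
  have jm: "j < m" "\<epsilon> < f j (xs T)" using sep x j(1) unfolding separation_oracle_def by fastforce+
  define g where "g = df j (xs T)"
  have g: "g \<in> carrier_vec n" unfolding g_def by (rule gradient_carrier[OF jm(1) x])
  define bg where "bg = 10 + n * n + n * n"
  define nm1 where "nm1 = nm(20 + T := j)"
  have nm1: "nm1 0 = n" "nm1 7 = n * n" "nm1 8 = T" "nm1 9 = pts + T * n" "nm1 10 = Suc j"
    using nm j by (simp_all add: nm1_def)
  have run1: "run orc (NStore (NAdd (NConst 20) (nreg 8)) (NSub (nreg 10) (NConst 1)))
      (mem nm r) [Tick] (mem nm1 r)"
    using run_NStore[of orc "NAdd (NConst 20) (nreg 8)" "NSub (nreg 10) (NConst 1)" "mem nm r"]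
    by (simp add: set_nmem_def nm1_def nm j)
  define r1 where "r1 i = (if bg \<le> i \<and> i < bg + n then g $ (i - bg) else r i)" for i
  have xT: "xs T = get_vec n (nm1 9) (mem nm1 r)" by (simp add: xs_def nm1 get_vec_def)
  have s1: "set_vec n bg g (mem nm1 r) = mem nm1 r1" by (simp add: set_vec_def r1_def fun_eq_iff)
  have run2: "run orc (Gradient (NSub (nreg 10) (NConst 1)) (nreg 9) addr_grad) (mem nm1 r) [GradCall] (mem nm1 r1)"
  proof -
    have a: "nval addr_grad (mem nm1 r) = bg" by (simp add: addr_defs nm1 bg_def)
    have "run orc (Gradient (NSub (nreg 10) (NConst 1)) (nreg 9) addr_grad) (mem nm1 r) [GradCall]
        (set_vec n bg (df j (xs T)) (mem nm1 r))"
      using run_Gradient[of "xs T" orc "nreg 9" "mem nm1 r" "NSub (nreg 10) (NConst 1)" addr_grad]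
        xT x jm(1) unfolding a by (simp add: nm1)
    then show ?thesis by (simp only: g_def[symmetric] s1)
  qed
  have A1: "get_mat n 10 (mem nm1 r1) = A" unfolding A_def by (rule get_mat_cong) (simp add: r1_def bg_def)
  have B1: "get_mat n (10 + n * n) (mem nm1 r1) = B" unfolding B_def
    by (rule get_mat_cong) (simp add: r1_def bg_def)
  have g1: "get_vec n (10 + n * n + n * n) (mem nm1 r1) = g"
    using get_vec_set_vec[OF g, of bg "mem nm1 r"] unfolding s1 by (simp add: bg_def)
  have r1o: "r1 z = r z" if "z < bg \<or> bg + n \<le> z" for z using that by (auto simp: r1_def)
  have x1: "get_vec n (nm1 9) (mem nm1 r1) = xs T" unfolding xs_def nm1
    by (rule get_vec_cong) (simp add: r1o pts_def bg_def)
  define w where "w = B *\<^sub>v g"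
  define q where "q = g \<bullet> w"
  define A' where "A' = A + step \<cdot>\<^sub>m outer n g g"
  define B' where "B' = B + (- (step / (1 + step * q))) \<cdot>\<^sub>m outer n w w"
  define y where "y = xs T - (1 / (1 + step * q)) \<cdot>\<^sub>v w"
  have r1': "r1 1 = \<epsilon>" "r1 2 = step" "r1 3 = r 3" using r by (simp_all add: r1_def bg_def)
  have p9: "10 + n * n + n * n + n + n + n \<le> nm1 9" by (simp add: nm1 pts_def)
  obtain nm2 r2 where run3: "timed orc update (mem nm1 r1) (27 + 21 * (n * n) + 21 * n) (mem nm2 r2)"
    and ag: "agree nm1 nm2" and A2: "get_mat n 10 (mem nm2 r2) = A'"
    and B2: "get_mat n (10 + n * n) (mem nm2 r2) = B'"
    and y2: "get_vec n (10 + n * n + n * n + n + n) (mem nm2 r2) = y"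
    and r2: "r2 3 = r 3 + q / (1 + step * q)" "r2 1 = \<epsilon>" "r2 2 = step" "\<And>z. pts \<le> z \<Longrightarrow> r2 z = r1 z"
    using update_run[OF nm1(1) n nm1(2) p9, where r = r1 and orc = orc] unfolding A1 B1 g1 x1 r1'
    unfolding w_def[symmetric] q_def[symmetric] A'_def[symmetric] B'_def[symmetric] y_def[symmetric] pts_def[symmetric]
    by metis
  obtain k where k: "k \<le> 27 + 21 * (n * n) + 21 * n" "run orc update (mem nm1 r1) (replicate k Tick) (mem nm2 r2)"
    using run3 by (auto simp: timed_def)
  have nm2: "nm2 0 = n" "nm2 7 = n * n" "nm2 8 = T" "nm2 9 = pts + T * n" and nm2i: "\<And>t. nm2 (20 + t) = nm1 (20 + t)"
    using ag nm1 by (auto simp: agree_def)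
  define z where "z = proj A' y"
  define r3 where "r3 i = (if pts + T * n + n \<le> i \<and> i < pts + T * n + n + n then z $ (i - (pts + T * n + n)) else r2 i)" for i
  define nm4 where "nm4 = nm2(9 := pts + T * n + n, 8 := Suc T)"
  define nm5 where "nm5 = nm4(10 := case sep z of None \<Rightarrow> 0 | Some j \<Rightarrow> j + 1)"
  define xs' where "xs' t = get_vec n (pts + t * n) (mem nm5 r3)" for t
  have s3: "set_vec n (pts + T * n + n) z (mem nm r2) = mem nm r3" for nm
    by (simp add: set_vec_def r3_def fun_eq_iff)
  \<comment> \<open>Earlier points are intact: in the point area the body writes only the block
    behind point \<open>T\<close>.\<close>
  have xs': "xs' t = xs t" if "t \<le> T" for t
    unfolding xs'_def xs_def
  proof (rule get_vec_cong)
    fix i assume i: "i < n"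
    have "t * n \<le> T * n" using that by simp
    then have "t * n + i < T * n + n" using i by linarith
    then show "r3 (pts + t * n + i) = r (pts + t * n + i)"
      using i by (simp add: r3_def r2(4) r1o pts_def bg_def)
  qed
  have js': "nm5 (20 + t) = (if t = T then j else nm (20 + t))" for t
    using nm2i[of t] by (simp add: nm5_def nm4_def nm1_def)
  \<comment> \<open>Conditional, since the dimension of \<open>z\<close> is known only once
    \<open>z\<close> is seen to lie in the simplex.\<close>
  have zs: "xs' (Suc T) = z" if "z \<in> carrier_vec n"
    using get_vec_set_vec[OF that, of "pts + T * n + n" "mem nm5 r2"] unfolding s3
    by (simp add: xs'_def add.assoc add.commute[of n])
  have zdef: "z = proj (A + step \<cdot>\<^sub>m outer n g g) (xs T - (1 / (1 + step * (g \<bullet> (B *\<^sub>v g)))) \<cdot>\<^sub>v (B *\<^sub>v g))"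
    by (simp add: z_def A'_def y_def w_def q_def)
  \<comment> \<open>The step lemma is first applied to artificial histories, to show that the
    projection call is admissible; afterwards it applies to the histories stored in memory.\<close>
  have psd: "pos_semidef n A'" and zS: "z \<in> simplex n"
    using ons_inv_step(2,3)[OF ons, of "(\<lambda>t. nm (20 + t))(T := j)" "xs(Suc T := z)"] jm zdef
    by (simp_all add: A'_def g_def)
  have zs': "xs' (Suc T) = z" by (rule zs[OF simplex_carrier[OF zS]])
  have ons': "ons_inv (Suc T) A' B' (r 3 + q / (1 + step * q)) (\<lambda>t. nm5 (20 + t)) xs'"
    using ons_inv_step(1)[OF ons, of "\<lambda>t. nm5 (20 + t)" xs'] jm xs' js' zs' zdef
    by (simp add: A'_def B'_def g_def q_def w_def)
  have run4: "run orc (Project (NConst 10) addr_tgt (NAdd (nreg 9) (nreg 0))) (mem nm2 r2) [ProjCall] (mem nm2 r3)"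
  proof -
    have t: "nval addr_tgt (mem nm2 r2) = 10 + n * n + n * n + n + n" by (simp add: addr_defs nm2)
    have "run orc (Project (NConst 10) addr_tgt (NAdd (nreg 9) (nreg 0))) (mem nm2 r2) [ProjCall]
        (set_vec n (pts + T * n + n) z (mem nm2 r2))"
      using run_Project[of A' orc "NConst 10" "mem nm2 r2" y addr_tgt "NAdd (nreg 9) (nreg 0)"] psd
      unfolding t oracles.select_convs y2 by (simp add: A2 nm2 z_def)
    then show ?thesis by (simp only: s3)
  qed
  have run5: "run orc (NStore (NConst 9) (NAdd (nreg 9) (nreg 0))) (mem nm2 r3) [Tick]
      (mem (nm2(9 := pts + T * n + n)) r3)"
    using run_NStore[of orc "NConst 9" "NAdd (nreg 9) (nreg 0)" "mem nm2 r3"]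
    by (simp add: set_nmem_def nm2)
  have run5': "run orc (NStore (NConst 8) (NAdd (nreg 8) (NConst 1))) (mem (nm2(9 := pts + T * n + n)) r3) [Tick]
      (mem nm4 r3)"
    using run_NStore[of orc "NConst 8" "NAdd (nreg 8) (NConst 1)" "mem (nm2(9 := pts + T * n + n)) r3"]
    by (simp add: set_nmem_def nm2 nm4_def)
  have z4: "get_vec n (nm4 9) (mem nm4 r3) = z"
    using zs' by (simp add: xs'_def get_vec_def nm4_def add.assoc add.commute[of n])
  have run6: "run orc (Separate (nreg 9) (NConst 10)) (mem nm4 r3) [SepCall] (mem nm5 r3)"
    using run_Separate[of z orc "nreg 9" "mem nm4 r3" "NConst 10"] z4 zS
    by (simp add: set_nmem_def nm5_def)
  have "run orc body (mem nm r) ([Tick] @ [GradCall] @ replicate k Tick @ [ProjCall] @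
      [Tick] @ [Tick] @ [SepCall]) (mem nm5 r3)"
    unfolding body_def
    by (rule run_Seq[OF run1 run_Seq[OF run2 run_Seq[OF k(2) run_Seq[OF run4 run_Seq[OF run5
          run_Seq[OF run5' run6]]]]]])
  then have "run orc body (mem nm r) (replicate 1 Tick @ [GradCall] @ replicate k Tick @ [ProjCall] @
      replicate 2 Tick @ [SepCall]) (mem nm5 r3)" by (simp add: numeral_2_eq_2)
  moreover have "1 + k + 2 \<le> 30 + 21 * (n * n) + 21 * n" using k(1) by simp
  moreover have "state_inv (Suc T) nm5 r3"
  proof -
    have "get_mat n 10 (mem nm5 r3) = A'"
      unfolding A2[symmetric] by (rule get_mat_cong) (simp add: r3_def pts_def)
    moreover have "get_mat n (10 + n * n) (mem nm5 r3) = B'"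
      unfolding B2[symmetric] by (rule get_mat_cong) (simp add: r3_def pts_def)
    moreover have "r3 3 = r 3 + q / (1 + step * q)" "r3 1 = \<epsilon>" "r3 2 = step"
      using r2 by (simp_all add: r3_def pts_def)
    moreover have "get_vec n (nm5 9) (mem nm5 r3) = z"
      using z4 by (simp add: nm5_def nm4_def get_vec_def)
    moreover have "nm5 10 = (case sep z of None \<Rightarrow> 0 | Some j \<Rightarrow> j + 1)" "nm5 0 = n" "nm5 7 = n * n"
      "nm5 8 = Suc T" "nm5 9 = pts + Suc T * n"
      by (simp_all add: nm5_def nm4_def nm2)
    ultimately show ?thesis using ons' unfolding state_inv_def xs'_def by simp
  qed
  ultimately show ?thesis by blast
qed

text \<open>If the last answer is FAIL, the current point is the solution. Otherwise the guard
  failed because the threshold test did, and the recorded cuts form a certificate.\<close>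

lemma finish_run:
  assumes I: "state_inv T nm r" and stop: "\<not> bval loop_guard (mem nm r)"
  obtains s where "timed orc finish (mem nm r) 5 s" "approximate_solution n m f df \<epsilon> (result n s)"
proof (cases "nm 10 = 0")
  case True
  define nm' where "nm' = nm(1 := nm 9, 0 := 0)"
  have t: "timed orc finish (mem nm r) (Suc 2) (mem nm' r)"
    unfolding finish_def nm'_def
    by (rule timed_Cond) (use True in \<open>auto intro!: timed_Seq[OF timed_NStore timed_NStore]\<close>)
  have "timed orc finish (mem nm r) 5 (mem nm' r)" by (rule timed_mono[OF t]) simp
  moreover have "approximate_solution n m f df \<epsilon> (result n (mem nm' r))"
  proof -
    define x where "x = get_vec n (nm 9) (mem nm r)"
    have x: "x \<in> simplex n" using I by (auto simp: state_inv_def ons_inv_def x_def)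
    have "sep x = None" using I True by (auto simp: state_inv_def x_def split: option.splits)
    then have "\<forall>j<m. f j x \<le> \<epsilon>" using sep x by (force simp: separation_oracle_def)
    moreover have "result n (mem nm' r) = Solution x"
      by (simp add: result_def nm'_def x_def get_vec_def)
    ultimately show ?thesis using x by simp
  qed
  ultimately show thesis by (rule that)
next
  case False
  have nm: "nm 0 = n" "nm 7 = n * n" "nm 8 = T" using I by (auto simp: state_inv_def)
  define nm' where "nm' = nm(3 := pts, 2 := 20, 1 := T, 0 := 1)"
  have "timed orc (NStore (NConst 3) addr_pts ;; NStore (NConst 2) (NConst 20) ;;
      NStore (NConst 1) (nreg 8) ;; NStore (NConst 0) (NConst 1)) (mem nm r) 4 (mem nm' r)"
    unfolding nm'_def
    by (rule timed_Seq[OF timed_NStore timed_Seq[OF timed_NStore timed_Seq[OF timed_NStore timed_NStore]]])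
      (rule order_refl | simp add: addr_defs nm pts_def)+
  then have "timed orc finish (mem nm r) (Suc 4) (mem nm' r)"
    unfolding finish_def by (intro timed_Cond) (use False in simp)
  moreover have "approximate_solution n m f df \<epsilon> (result n (mem nm' r))"
  proof -
    have "result n (mem nm' r) =
        Infeasible (map (\<lambda>t. (nm (20 + t), get_vec n (pts + t * n) (mem nm r))) [0..<T])"
      by (simp add: result_def nm'_def get_vec_def)
    moreover have "r 3 \<le> real T * \<epsilon>"
      using stop False I by (simp add: loop_guard_def state_inv_def not_less)
    ultimately show ?thesis using I ons_certificate by (auto simp: state_inv_def)
  qed
  ultimately show thesis using that by simp
qed

text \<open>The bound of \<open>ons_step_bound\<close>, rounded up, so that a true guard implies
  \<open>T < max_steps\<close>.\<close>

definition max_steps :: nat where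
  "max_steps = nat \<lceil>8 * ratio + 1 + 4 * ratio * ln (4 * ratio)\<rceil>"

text \<open>Induction on the number of rounds left. The trace of \<open>finish\<close> is appended
  because the last stretch without separation calls reaches to the end of the program.\<close>

lemma loop_run:
  assumes I: "state_inv T nm r"
  shows "\<exists>tr s tr' s'. run orc (While loop_guard body) (mem nm r) tr s \<and> run orc finish s tr' s' \<and>
    between_calls (tr @ tr') (real (100 * (n * n))) \<and>
    count_list (tr @ tr') SepCall \<le> max_steps - T \<and> approximate_solution n m f df \<epsilon> (result n s')"
  using I
proof (induction "max_steps - T" arbitrary: T nm r rule: less_induct)
  case less
  have "1 \<le> n * n" "n \<le> n * n" using n by simp_all
  \<comment> \<open>The first bound covers the failing guard test and \<open>finish\<close>, the
    second a successful guard test and the body.\<close>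
  then have nn: "6 \<le> 100 * (n * n)" "31 + 21 * (n * n) + 21 * n \<le> 100 * (n * n)" by linarith+
  show ?case
  proof (cases "bval loop_guard (mem nm r)")
    case False
    obtain s where "timed orc finish (mem nm r) 5 s" and sol: "approximate_solution n m f df \<epsilon> (result n s)"
      by (rule finish_run[OF less.prems False])
    then obtain k where k: "k \<le> 5" "run orc finish (mem nm r) (replicate k Tick) s"
      by (auto simp: timed_def)
    have b: "between_calls ([Tick] @ replicate k Tick) (real (100 * (n * n)))"
      by (rule between_calls_segment) (use k nn in \<open>auto simp: count_list_replicate\<close>)
    have c: "count_list ([Tick] @ replicate k Tick) SepCall \<le> max_steps - T"
      by (simp add: count_list_replicate)
    show ?thesis by (intro exI conjI) (rule run_WhileFalse[OF False] k(2) b c sol)+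
  next
    case True
    have "0 < nm 10" "real T * \<epsilon> < r 3"
      using True less.prems by (simp_all add: loop_guard_def state_inv_def)
    then have "real T < 8 * ratio + 1 + 4 * ratio * ln (4 * ratio)"
      using less.prems ons_step_bound by (auto simp: state_inv_def)
    then have T: "T < max_steps" unfolding max_steps_def by linarith
    obtain k1 k2 k3 nm' r' where b: "run orc body (mem nm r)
        (replicate k1 Tick @ [GradCall] @ replicate k2 Tick @ [ProjCall] @ replicate k3 Tick @ [SepCall])
        (mem nm' r')" and k: "k1 + k2 + k3 \<le> 30 + 21 * (n * n) + 21 * n" and I': "state_inv (Suc T) nm' r'"
      using body_run[OF less.prems \<open>0 < nm 10\<close>] by blast
    obtain tr s tr' s' where IH: "run orc (While loop_guard body) (mem nm' r') tr s" "run orc finish s tr' s'"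
      "between_calls (tr @ tr') (real (100 * (n * n)))"
      "count_list (tr @ tr') SepCall \<le> max_steps - Suc T" "approximate_solution n m f df \<epsilon> (result n s')"
      using less.hyps[OF diff_less_mono2[OF lessI T] I'] by blast
    define seg where "seg = Tick # replicate k1 Tick @ [GradCall] @ replicate k2 Tick @ [ProjCall] @ replicate k3 Tick"
    have W: "run orc (While loop_guard body) (mem nm r) (seg @ SepCall # tr) s"
      using run_WhileTrue[OF True b IH(1)] by (simp add: seg_def)
    have "between_calls seg (real (100 * (n * n)))"
      by (rule between_calls_segment) (use k nn in \<open>auto simp: seg_def count_list_replicate\<close>)
    then have "between_calls (seg @ SepCall # (tr @ tr')) (real (100 * (n * n)))"
      using IH(3) by (rule between_calls_SepCall)
    moreover have "count_list (seg @ SepCall # (tr @ tr')) SepCall \<le> max_steps - T"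
      using IH(4) T by (simp add: seg_def count_list_replicate)
    ultimately show ?thesis using W IH(2,5)
      by (intro exI[of _ "seg @ SepCall # tr"] exI[of _ s] exI[of _ tr'] exI[of _ s']) simp
  qed
qed

text \<open>The extra separation call is the one at the starting vertex, before the loop.\<close>

lemma newton_program_run:
  "\<exists>tr s. run orc newton_program (initial n m G \<epsilon>) tr s \<and> approximate_solution n m f df \<epsilon> (result n s) \<and>
    count_list tr SepCall \<le> Suc max_steps \<and> between_calls tr (real (100 * (n * n)))"
proof -
  obtain nm r where init: "timed orc init (initial n m G \<epsilon>) (17 + 14 * (n * n) + 10 * n) (mem nm r)"
    and nm: "nm 0 = n" "nm 7 = n * n" "nm 8 = 0" "nm 9 = pts"
    and r: "r 1 = \<epsilon>" "r 2 = step" "r 3 = 2 * reg"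
    and AB: "get_mat n 10 (mem nm r) = reg \<cdot>\<^sub>m 1\<^sub>m n" "get_mat n (10 + n * n) (mem nm r) = (1 / reg) \<cdot>\<^sub>m 1\<^sub>m n"
    and x: "get_vec n pts (mem nm r) = unit_vec n 0"
    unfolding pts_def step_def reg_def by (rule init_run[OF n])
  obtain k where k: "k \<le> 17 + 14 * (n * n) + 10 * n"
    "run orc init (initial n m G \<epsilon>) (replicate k Tick) (mem nm r)"
    using init by (auto simp: timed_def)
  have xS: "unit_vec n 0 \<in> simplex n" using n by (intro unit_vec_in_simplex) simp
  define nm' where "nm' = nm(10 := case sep (unit_vec n 0) of None \<Rightarrow> 0 | Some j \<Rightarrow> j + 1)"
  have S: "run orc (Separate (nreg 9) (NConst 10)) (mem nm r) [SepCall] (mem nm' r)"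
    using run_Separate[of "unit_vec n 0" orc "nreg 9" "mem nm r" "NConst 10"] xS
    by (simp add: nm x set_nmem_def nm'_def)
  have v: "get_vec n b (mem nm' r) = get_vec n b (mem nm r)"
    "get_mat n b (mem nm' r) = get_mat n b (mem nm r)" for b
    by (simp_all add: get_vec_def get_mat_def)
  have "state_inv 0 nm' r"
    unfolding state_inv_def v AB r
    using ons_inv_init[of "\<lambda>t. get_vec n (pts + t * n) (mem nm r)" "\<lambda>t. nm' (20 + t)"]
    by (simp add: nm'_def nm x)
  then obtain tr s tr' s' where L: "run orc (While loop_guard body) (mem nm' r) tr s" "run orc finish s tr' s'"
      "between_calls (tr @ tr') (real (100 * (n * n)))"
      "count_list (tr @ tr') SepCall \<le> max_steps" "approximate_solution n m f df \<epsilon> (result n s')"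
    using loop_run[of 0 nm' r] by auto
  have "run orc newton_program (initial n m G \<epsilon>) (replicate k Tick @ [SepCall] @ tr @ tr') s'"
    unfolding newton_program_def by (rule run_Seq[OF k(2) run_Seq[OF S run_Seq[OF L(1,2)]]])
  then have run: "run orc newton_program (initial n m G \<epsilon>) (replicate k Tick @ SepCall # (tr @ tr')) s'"
    by simp
  have "n \<le> n * n" "1 \<le> n * n" using n by simp_all
  then have "17 + 14 * (n * n) + 10 * n \<le> 100 * (n * n)" by linarith
  then have "between_calls (replicate k Tick) (real (100 * (n * n)))"
    using k(1) by (intro between_calls_segment) (auto simp: count_list_replicate)
  then have "between_calls (replicate k Tick @ SepCall # (tr @ tr')) (real (100 * (n * n)))"
    using L(3) by (rule between_calls_SepCall)
  moreover have "count_list (replicate k Tick @ SepCall # (tr @ tr')) SepCall \<le> Suc max_steps"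
    using L(4) by (simp add: count_list_replicate)
  ultimately show ?thesis using run L(5) by blast
qed

text \<open>With \<open>ln 4 \<le> 3\<close> and \<open>1 \<le> ratio\<close>, the bound is at most
  \<open>23 * ratio + 4 * L\<close>, well within the constant 100; one logarithmic factor is
  enough.\<close>

lemma max_steps_le: "real (Suc max_steps) \<le> soft_O 100 1 (real n * G / \<epsilon>)"
proof -
  have X: "1 \<le> ratio" by (simp add: ratio_def)
  have "ln (4 * ratio) = ln 4 + ln ratio" using X by (simp add: ln_mult)
  also have "\<dots> \<le> 3 + ln ratio" using ln_le_minus_one[of 4] by simp
  finally have "ratio * ln (4 * ratio) \<le> ratio * (3 + ln ratio)" using X by (intro mult_left_mono) auto
  moreover define K L where "K = ratio * ln (4 * ratio)" and "L = ratio * ln ratio"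
  ultimately have K: "K \<le> 3 * ratio + L" by (simp add: algebra_simps)
  define Y where "Y = 8 * ratio + 1 + 4 * ratio * ln (4 * ratio)"
  have "0 \<le> ln (4 * ratio)" using X by (intro ln_ge_zero) simp
  then have "0 \<le> Y" using X unfolding Y_def by (intro add_nonneg_nonneg mult_nonneg_nonneg) auto
  then have "real max_steps \<le> Y + 1"
    unfolding max_steps_def Y_def[symmetric]
    using of_int_ceiling_le_add_one[of Y] by simp
  moreover have "Y = 8 * ratio + 1 + 4 * K" by (simp add: Y_def K_def)
  moreover have "0 \<le> L" using X by (simp add: L_def)
  ultimately have "real (Suc max_steps) \<le> 100 * (ratio + L)" using X K by simp
  also have "\<dots> = 100 * (ratio + ratio * ln ratio)" by (simp add: L_def)
  also have "\<dots> = soft_O 100 1 (real n * G / \<epsilon>)"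
    unfolding soft_O_def ratio_def[symmetric] by (simp add: algebra_simps)
  finally show ?thesis .
qed

end

theorem theorem4:
  shows "\<exists>(alg :: com) (C :: real) (k :: nat).
    \<forall>(n :: nat) (m :: nat) (f :: nat \<Rightarrow> real vec \<Rightarrow> real) (df :: nat \<Rightarrow> real vec \<Rightarrow> real vec)
      (G :: real) (\<epsilon> :: real) (sep :: real vec \<Rightarrow> nat option) (proj :: real mat \<Rightarrow> real vec \<Rightarrow> real vec).
      1 \<le> n \<longrightarrow> 1 \<le> m \<longrightarrow>
      convex_program n m f df \<longrightarrow>
      (\<forall>j<m. \<forall>x\<in>simplex n. l2norm (df j x) \<le> G) \<longrightarrow>
      0 < \<epsilon> \<longrightarrow>
      separation_oracle n m f \<epsilon> sep \<longrightarrow>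
      projection_oracle n proj \<longrightarrow>
      (\<exists>tr s.
         run \<lparr>dim = n, num = m, separate = sep, gradient = df, project = proj\<rparr>
           alg (initial n m G \<epsilon>) tr s \<and>
         approximate_solution n m f df \<epsilon> (result n s) \<and>
         real (count_list tr SepCall) \<le> soft_O C k (real n * G / \<epsilon>) \<and>
         between_calls tr (soft_O C k ((real n)\<^sup>2)))"
\<comment> \<open>The constants 100 and 1 serve both the oracle calls and the time in
  between.\<close>
proof (rule exI[of _ newton_program], rule exI[of _ 100], rule exI[of _ 1], intro allI impI)
  fix n m :: nat and f df and G \<epsilon> :: real and sep proj
  assume "1 \<le> n" "1 \<le> m" "convex_program n m f df" "\<forall>j<m. \<forall>x\<in>simplex n. l2norm (df j x) \<le> G"
    "0 < \<epsilon>" "separation_oracle n m f \<epsilon> sep" "projection_oracle n proj"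
  then interpret feasibility_instance n m f df G \<epsilon> sep proj
    by (intro feasibility_instance.intro) simp_all
  obtain tr s where R: "run orc newton_program (initial n m G \<epsilon>) tr s"
    "approximate_solution n m f df \<epsilon> (result n s)" "count_list tr SepCall \<le> Suc max_steps"
    "between_calls tr (real (100 * (n * n)))"
    using newton_program_run by blast
  \<comment> \<open>The time bound is a pure multiple of the square of \<open>n\<close>; the
    logarithmic factor of \<open>soft_O\<close> is at least 1.\<close>
  have "1 \<le> (real n)\<^sup>2" using n by simp
  then have "100 * (real n)\<^sup>2 * 1 \<le> 100 * (real n)\<^sup>2 * (1 + ln ((real n)\<^sup>2))"
    by (intro mult_left_mono) auto
  moreover have "real (100 * (n * n)) = 100 * (real n)\<^sup>2 * 1" by (simp add: power2_eq_square)
  moreover have "soft_O 100 1 ((real n)\<^sup>2) = 100 * (real n)\<^sup>2 * (1 + ln ((real n)\<^sup>2))"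
    using \<open>1 \<le> (real n)\<^sup>2\<close> by (simp only: soft_O_def max_absorb2 power_one_right)
  ultimately have "real (100 * (n * n)) \<le> soft_O 100 1 ((real n)\<^sup>2)" by linarith
  then have "between_calls tr (soft_O 100 1 ((real n)\<^sup>2))"
    using R(4) by (rule between_calls_mono[rotated])
  moreover have "real (count_list tr SepCall) \<le> soft_O 100 1 (real n * G / \<epsilon>)"
    using R(3) max_steps_le by linarith
  ultimately show "\<exists>tr s. run orc newton_program (initial n m G \<epsilon>) tr s \<and>
      approximate_solution n m f df \<epsilon> (result n s) \<and>
      real (count_list tr SepCall) \<le> soft_O 100 1 (real n * G / \<epsilon>) \<and>
      between_calls tr (soft_O 100 1 ((real n)\<^sup>2))"
    using R(1,2) by (intro exI[of _ tr] exI[of _ s]) simp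
qed

end
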